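(* The strict model structure on the category of pro-simplicial sets (that is, on $\mathrm{pro}\text{-}\mathcal{C}$ with $\mathcal{C}$ the category of simplicial sets with its usual model structure) is not fibrantly generated.
   Context: A category $I$ is cofiltering (cofiltered) if it is non-empty and small; for all objects $s,t$ there is an object $u$ with maps $u\to s$ and $u\to t$; and for all parallel morphisms $f,g$ there is a morphism $h$ with $fh=gh$. The category $\mathrm{pro}\text{-}\mathcal{C}$ has as objects all functors from cofiltering categories to $\mathcal{C}$ and morphisms $\mathrm{Hom}(X,Y)=\lim_s\operatorname{colim}_t \mathrm{Hom}_{\mathcal{C}}(X_t,Y_s)$, with the natural composition. A directed set (a non-empty partially ordered set in which any two elements have an upper bound) is regarded as a cofiltering category with an arrow $t\to s$ whenever $t\ge s$. It is cofinite if for every $t$ the set $\{s : s\le t\}$ is finite. A level representation of a map $f:X\to Y$ in $\mathrm{pro}\text{-}\mathcal{C}$ consists of a cofiltered category $I$, functors $\tilde X,\tilde Y:I\to\mathcal{C}$, isomorphisms $X\cong\tilde X$, $Y\cong\tilde Y$ in $\mathrm{pro}\text{-}\mathcal{C}$, and a natural transformation $\{f_s:\tilde X_s\to\tilde Y_s\}_{s\in I}$ whose induced map in $\mathrm{pro}\text{-}\mathcal{C}$ corresponds to $f$ under these isomorphisms. It is cofinite directed if $I$ is a cofinite directed set. A map of $\mathrm{pro}\text{-}\mathcal{C}$ has a property essentially levelwise if it has some level representation all of whose maps $f_s$ have the property. For a cofinite directed level representation $f:X\to Y$ and an index $t$, the relative matching map $M_tf$ is the natural map $X_t\to \left(\lim_{s<t}X_s\right)\times_{\lim_{s<t}Y_s}Y_t$.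 For a proper model category $\mathcal{C}$ (such as simplicial sets with weak homotopy equivalences, monomorphisms and Kan fibrations), the strict model structure on $\mathrm{pro}\text{-}\mathcal{C}$ has: as weak equivalences the essentially levelwise weak equivalences; as cofibrations the essentially levelwise cofibrations; as fibrations the retracts of special fibrations, where a special fibration is a map having a cofinite directed level representation $p$ for which every $M_sp$ is a fibration in $\mathcal{C}$. "Fibrantly generated" is the dual of "cofibrantly generated". Explicitly, for an ordinal $\lambda$ (identified with the ordered set of ordinals less than $\lambda$), a $\lambda$-tower is a contravariant functor $Z$ from $\lambda$ such that for every limit ordinal $\beta<\lambda$, $Z_\beta\cong\lim_{\alpha<\beta}Z_\alpha$ (canonically). For a class $D$ of maps, a $D$-cocell complex is a map isomorphic to the projection $\lim_{\beta<\lambda}Z_\beta\to Z_0$ of some $\lambda$-tower $Z$ (for some $\lambda$) in which each $Z_{\beta+1}\to Z_\beta$ is a base change of a map in $D$. An object $W$ is cosmall relative to $D$ if there is a cardinal $\kappa$ such that for every regular cardinal $\lambda\ge\kappa$ and every $\lambda$-tower $Z$ in which each $Z_{\beta+1}\to Z_\beta$ is a $D$-cocell complex, the map $\operatorname{colim}_{\beta<\lambda}\mathrm{Hom}(Z_\beta,W)\to\mathrm{Hom}(\lim_{\beta<\lambda}Z_\beta,W)$ is a bijection. A model category is fibrantly generated if there are sets (not proper classes) of maps $I$ (generating fibrations) and $J$ (generating acyclic fibrations) such that the codomains of the maps in $I$ (resp. $J$) are cosmall relative to $I$ (resp. $J$); a map is an acyclic cofibration if and only if it has the left lifting property with respect to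 every map in $I$; and a map is a cofibration if and only if it has the left lifting property with respect to every map in $J$. *)

theory Defs
  imports "HOL-Homology.Homology"
begin

unbundle cardinal_syntax

section \<open>The universe of sets\<close>

text \<open>
  The distinction between sets and proper classes is made relative to a type \<open>'v\<close> whose
  cardinality is inaccessible: a collection (of any type) is \<^emph>\<open>small\<close>, that is, it plays the role of
  a set, if it has strictly smaller cardinality than \<open>'v\<close>. Up to bijection the small
  collections are the small subsets of \<open>'v\<close>, and these serve as the sets of a Grothendieck universe
  containing an infinite set.
\<close>

definition small :: "'v itself \<Rightarrow> 'a set \<Rightarrow> bool" where
  "small V A \<longleftrightarrow> |A| <o |UNIV :: 'v set|"

definition inaccessible_universe :: "'v itself \<Rightarrow> bool" where
  "inaccessible_universe V \<longleftrightarrow>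
     natLeq <o |UNIV :: 'v set| \<and>
     regularCard |UNIV :: 'v set| \<and>
     (\<forall>A :: 'v set. small V A \<longrightarrow> small V (Pow A))"


section \<open>Categories\<close>

text \<open>
  The values of \<open>Dom\<close>, \<open>Cod\<close>, \<open>Ident\<close> and \<open>Comp\<close> (and, below, of the fields of a diagram) matter
  only on the carriers. Index categories or diagrams which differ only off the carriers give
  distinct but isomorphic pro-objects; values of morphisms are always extensional, so that equality
  of morphisms is the intended one.
\<close>

record ('o, 'm) category =
  Obj :: "'o set"
  Arr :: "'m set"
  Dom :: "'m \<Rightarrow> 'o"
  Cod :: "'m \<Rightarrow> 'o"
  Ident :: "'o \<Rightarrow> 'm"
  Comp :: "'m \<Rightarrow> 'm \<Rightarrow> 'm" (infixl "\<cdot>\<index>" 70)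

definition Hom :: "('o, 'm, 'z) category_scheme \<Rightarrow> 'o \<Rightarrow> 'o \<Rightarrow> 'm set" where
  "Hom C x y = {f \<in> Arr C. Dom C f = x \<and> Cod C f = y}"

definition is_category :: "('o, 'm, 'z) category_scheme \<Rightarrow> bool" where
  "is_category C \<longleftrightarrow>
     (\<forall>f \<in> Arr C. Dom C f \<in> Obj C \<and> Cod C f \<in> Obj C) \<and>
     (\<forall>x \<in> Obj C. Ident C x \<in> Hom C x x) \<and>
     (\<forall>f \<in> Arr C. \<forall>g \<in> Arr C. Dom C g = Cod C f \<longrightarrow>
        g \<cdot>\<^bsub>C\<^esub> f \<in> Hom C (Dom C f) (Cod C g)) \<and>
     (\<forall>f \<in> Arr C. f \<cdot>\<^bsub>C\<^esub> Ident C (Dom C f) = f \<and> Ident C (Cod C f) \<cdot>\<^bsub>C\<^esub> f = f) \<and>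
     (\<forall>f \<in> Arr C. \<forall>g \<in> Arr C. \<forall>h \<in> Arr C. Dom C g = Cod C f \<longrightarrow> Dom C h = Cod C g \<longrightarrow>
        h \<cdot>\<^bsub>C\<^esub> (g \<cdot>\<^bsub>C\<^esub> f) = (h \<cdot>\<^bsub>C\<^esub> g) \<cdot>\<^bsub>C\<^esub> f)"

definition op_category :: "('o, 'm) category \<Rightarrow> ('o, 'm) category" where
  "op_category C =
     \<lparr>Obj = Obj C, Arr = Arr C, Dom = Cod C, Cod = Dom C, Ident = Ident C,
      Comp = (\<lambda>g f. f \<cdot>\<^bsub>C\<^esub> g)\<rparr>"

definition inverse_arrows :: "('o, 'm, 'z) category_scheme \<Rightarrow> 'm \<Rightarrow> 'm \<Rightarrow> bool" where
  "inverse_arrows C f g \<longleftrightarrow>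
     f \<in> Arr C \<and> g \<in> Hom C (Cod C f) (Dom C f) \<and>
     g \<cdot>\<^bsub>C\<^esub> f = Ident C (Dom C f) \<and> f \<cdot>\<^bsub>C\<^esub> g = Ident C (Cod C f)"

definition iso_in :: "('o, 'm, 'z) category_scheme \<Rightarrow> 'm \<Rightarrow> bool" where
  "iso_in C f \<longleftrightarrow> (\<exists>g. inverse_arrows C f g)"

definition monic_in :: "('o, 'm, 'z) category_scheme \<Rightarrow> 'm \<Rightarrow> bool" where
  "monic_in C f \<longleftrightarrow>
     f \<in> Arr C \<and>
     (\<forall>T \<in> Obj C. \<forall>u \<in> Hom C T (Dom C f). \<forall>v \<in> Hom C T (Dom C f).
        f \<cdot>\<^bsub>C\<^esub> u = f \<cdot>\<^bsub>C\<^esub> v \<longrightarrow> u = v)"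

definition isomorphic_arrows :: "('o, 'm, 'z) category_scheme \<Rightarrow> 'm \<Rightarrow> 'm \<Rightarrow> bool" where
  "isomorphic_arrows C f g \<longleftrightarrow>
     f \<in> Arr C \<and> g \<in> Arr C \<and>
     (\<exists>a b. a \<in> Hom C (Dom C f) (Dom C g) \<and> b \<in> Hom C (Cod C f) (Cod C g) \<and>
            iso_in C a \<and> iso_in C b \<and> b \<cdot>\<^bsub>C\<^esub> f = g \<cdot>\<^bsub>C\<^esub> a)"

definition is_retract_of_arrow :: "('o, 'm, 'z) category_scheme \<Rightarrow> 'm \<Rightarrow> 'm \<Rightarrow> bool" where
  "is_retract_of_arrow C f g \<longleftrightarrow>
     f \<in> Arr C \<and> g \<in> Arr C \<and>
     (\<exists>i r j q.
        i \<in> Hom C (Dom C f) (Dom C g) \<and> r \<in> Hom C (Dom C g) (Dom C f) \<and>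
        j \<in> Hom C (Cod C f) (Cod C g) \<and> q \<in> Hom C (Cod C g) (Cod C f) \<and>
        r \<cdot>\<^bsub>C\<^esub> i = Ident C (Dom C f) \<and> q \<cdot>\<^bsub>C\<^esub> j = Ident C (Cod C f) \<and>
        j \<cdot>\<^bsub>C\<^esub> f = g \<cdot>\<^bsub>C\<^esub> i \<and> q \<cdot>\<^bsub>C\<^esub> g = f \<cdot>\<^bsub>C\<^esub> r)"

definition has_left_lifting :: "('o, 'm, 'z) category_scheme \<Rightarrow> 'm \<Rightarrow> 'm \<Rightarrow> bool" where
  "has_left_lifting C f p \<longleftrightarrow>
     (\<forall>u v. u \<in> Hom C (Dom C f) (Dom C p) \<longrightarrow> v \<in> Hom C (Cod C f) (Cod C p) \<longrightarrow>
        p \<cdot>\<^bsub>C\<^esub> u = v \<cdot>\<^bsub>C\<^esub> f \<longrightarrow>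
        (\<exists>h. h \<in> Hom C (Cod C f) (Dom C p) \<and> h \<cdot>\<^bsub>C\<^esub> f = u \<and> p \<cdot>\<^bsub>C\<^esub> h = v))"

definition pullback_square ::
  "('o, 'm, 'z) category_scheme \<Rightarrow> 'm \<Rightarrow> 'm \<Rightarrow> 'o \<Rightarrow> 'm \<Rightarrow> 'm \<Rightarrow> bool" where
  "pullback_square C f g P p q \<longleftrightarrow>
     f \<in> Arr C \<and> g \<in> Arr C \<and> Cod C f = Cod C g \<and>
     P \<in> Obj C \<and> p \<in> Hom C P (Dom C f) \<and> q \<in> Hom C P (Dom C g) \<and>
     f \<cdot>\<^bsub>C\<^esub> p = g \<cdot>\<^bsub>C\<^esub> q \<and>
     (\<forall>T \<in> Obj C. \<forall>u \<in> Hom C T (Dom C f). \<forall>v \<in> Hom C T (Dom C g).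
        f \<cdot>\<^bsub>C\<^esub> u = g \<cdot>\<^bsub>C\<^esub> v \<longrightarrow>
        (\<exists>!w. w \<in> Hom C T P \<and> p \<cdot>\<^bsub>C\<^esub> w = u \<and> q \<cdot>\<^bsub>C\<^esub> w = v))"

definition is_base_change :: "('o, 'm, 'z) category_scheme \<Rightarrow> 'm \<Rightarrow> 'm \<Rightarrow> bool" where
  "is_base_change C d q \<longleftrightarrow> (\<exists>k e. pullback_square C d k (Dom C q) e q)"


section \<open>Diagrams, limits and functor categories\<close>

text \<open>A diagram is a functor bundled with its source category.\<close>

record ('i, 'a, 'o, 'm) diagram =
  Shape :: "('i, 'a) category"
  ObM :: "'i \<Rightarrow> 'o"
  ArM :: "'a \<Rightarrow> 'm"

definition is_functor :: "('o, 'm, 'z) category_scheme \<Rightarrow> ('i, 'a, 'o, 'm) diagram \<Rightarrow> bool" where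
  "is_functor C X \<longleftrightarrow>
     is_category (Shape X) \<and>
     (\<forall>s \<in> Obj (Shape X). ObM X s \<in> Obj C \<and>
        ArM X (Ident (Shape X) s) = Ident C (ObM X s)) \<and>
     (\<forall>a \<in> Arr (Shape X). ArM X a \<in> Hom C (ObM X (Dom (Shape X) a)) (ObM X (Cod (Shape X) a))) \<and>
     (\<forall>a \<in> Arr (Shape X). \<forall>b \<in> Arr (Shape X). Dom (Shape X) b = Cod (Shape X) a \<longrightarrow>
        ArM X (b \<cdot>\<^bsub>Shape X\<^esub> a) = ArM X b \<cdot>\<^bsub>C\<^esub> ArM X a)"

definition natural_transformation ::
  "('o, 'm, 'z) category_scheme \<Rightarrow> ('i, 'a, 'o, 'm) diagram \<Rightarrow> ('i, 'a, 'o, 'm) diagram \<Rightarrow>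
   ('i \<Rightarrow> 'm) \<Rightarrow> bool" where
  "natural_transformation C X Y \<tau> \<longleftrightarrow>
     Shape X = Shape Y \<and>
     (\<forall>s \<in> Obj (Shape X). \<tau> s \<in> Hom C (ObM X s) (ObM Y s)) \<and>
     (\<forall>a \<in> Arr (Shape X).
        ArM Y a \<cdot>\<^bsub>C\<^esub> \<tau> (Dom (Shape X) a) = \<tau> (Cod (Shape X) a) \<cdot>\<^bsub>C\<^esub> ArM X a)"

definition functor_category ::
  "('i, 'a) category \<Rightarrow> ('o, 'm, 'z) category_scheme \<Rightarrow>
   (('i, 'a, 'o, 'm) diagram,
    ('i, 'a, 'o, 'm) diagram \<times> ('i, 'a, 'o, 'm) diagram \<times> ('i \<Rightarrow> 'm)) category" where
  "functor_category I C =
     \<lparr>Obj = {X. Shape X = I \<and> is_functor C X},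
      Arr = {(X, Y, \<tau>). Shape X = I \<and> Shape Y = I \<and> is_functor C X \<and> is_functor C Y \<and>
                        natural_transformation C X Y \<tau> \<and> \<tau> \<in> extensional (Obj I)},
      Dom = (\<lambda>(X, Y, \<tau>). X),
      Cod = (\<lambda>(X, Y, \<tau>). Y),
      Ident = (\<lambda>X. (X, X, \<lambda>s \<in> Obj I. Ident C (ObM X s))),
      Comp = (\<lambda>(Y', Z, \<sigma>) (X, Y, \<tau>). (X, Z, \<lambda>s \<in> Obj I. \<sigma> s \<cdot>\<^bsub>C\<^esub> \<tau> s))\<rparr>"

definition limit_cone ::
  "('o, 'm, 'z) category_scheme \<Rightarrow> ('i, 'a, 'o, 'm) diagram \<Rightarrow> 'o \<Rightarrow> ('i \<Rightarrow> 'm) \<Rightarrow> bool" where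
  "limit_cone C X L \<pi> \<longleftrightarrow>
     L \<in> Obj C \<and>
     (\<forall>s \<in> Obj (Shape X). \<pi> s \<in> Hom C L (ObM X s)) \<and>
     (\<forall>a \<in> Arr (Shape X). ArM X a \<cdot>\<^bsub>C\<^esub> \<pi> (Dom (Shape X) a) = \<pi> (Cod (Shape X) a)) \<and>
     (\<forall>T \<in> Obj C. \<forall>\<rho>.
        (\<forall>s \<in> Obj (Shape X). \<rho> s \<in> Hom C T (ObM X s)) \<longrightarrow>
        (\<forall>a \<in> Arr (Shape X). ArM X a \<cdot>\<^bsub>C\<^esub> \<rho> (Dom (Shape X) a) = \<rho> (Cod (Shape X) a)) \<longrightarrow>
        (\<exists>!w. w \<in> Hom C T L \<and> (\<forall>s \<in> Obj (Shape X). \<pi> s \<cdot>\<^bsub>C\<^esub> w = \<rho> s)))"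

definition cofiltered :: "'v itself \<Rightarrow> ('i, 'a) category \<Rightarrow> bool" where
  "cofiltered V I \<longleftrightarrow>
     is_category I \<and> small V (Obj I) \<and> small V (Arr I) \<and> Obj I \<noteq> {} \<and>
     (\<forall>s \<in> Obj I. \<forall>t \<in> Obj I. \<exists>u \<in> Obj I. Hom I u s \<noteq> {} \<and> Hom I u t \<noteq> {}) \<and>
     (\<forall>s \<in> Obj I. \<forall>t \<in> Obj I. \<forall>f \<in> Hom I s t. \<forall>g \<in> Hom I s t.
        \<exists>h \<in> Arr I. Cod I h = s \<and> f \<cdot>\<^bsub>I\<^esub> h = g \<cdot>\<^bsub>I\<^esub> h)"

text \<open>The partially ordered set \<open>r\<close> as a category, with an arrow \<open>t \<rightarrow> s\<close> whenever \<open>t \<ge> s\<close>.\<close>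

definition poset_category :: "'i rel \<Rightarrow> ('i, 'i \<times> 'i) category" where
  "poset_category r =
     \<lparr>Obj = Field r, Arr = {(t, s). (s, t) \<in> r}, Dom = fst, Cod = snd, Ident = (\<lambda>s. (s, s)),
      Comp = (\<lambda>(t', s) (u, t). (u, s))\<rparr>"

definition restrict_below ::
  "'i rel \<Rightarrow> 'i \<Rightarrow> ('i, 'i \<times> 'i, 'o, 'm) diagram \<Rightarrow> ('i, 'i \<times> 'i, 'o, 'm) diagram" where
  "restrict_below r t X = X\<lparr>Shape := poset_category (Restr r (underS r t))\<rparr>"


section \<open>Pro-categories\<close>

text \<open>
  \<open>colim_t Hom(X_t, W)\<close> for a diagram \<open>X\<close> of cofiltered shape, as the usual quotient of the disjoint
  union.
\<close>

definition colim_carrier ::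
  "('o, 'm, 'z) category_scheme \<Rightarrow> ('i, 'a, 'o, 'm) diagram \<Rightarrow> 'o \<Rightarrow> ('i \<times> 'm) set" where
  "colim_carrier C X W = (SIGMA t : Obj (Shape X). Hom C (ObM X t) W)"

definition colim_rel ::
  "('o, 'm, 'z) category_scheme \<Rightarrow> ('i, 'a, 'o, 'm) diagram \<Rightarrow> 'o \<Rightarrow> ('i \<times> 'm) rel" where
  "colim_rel C X W =
     {((t, g), (t', g')).
        (t, g) \<in> colim_carrier C X W \<and> (t', g') \<in> colim_carrier C X W \<and>
        (\<exists>u \<in> Obj (Shape X). \<exists>a \<in> Hom (Shape X) u t. \<exists>b \<in> Hom (Shape X) u t'.
           g \<cdot>\<^bsub>C\<^esub> ArM X a = g' \<cdot>\<^bsub>C\<^esub> ArM X b)}"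

definition colim_Hom ::
  "('o, 'm, 'z) category_scheme \<Rightarrow> ('i, 'a, 'o, 'm) diagram \<Rightarrow> 'o \<Rightarrow> ('i \<times> 'm) set set" where
  "colim_Hom C X W = colim_carrier C X W // colim_rel C X W"

text \<open>
  The map \<open>colim_t Hom(X_t, W) \<rightarrow> colim_t Hom(X_t, W')\<close> induced by \<open>k : W \<rightarrow> W'\<close>: the class of
  \<open>(t, g)\<close> goes to the class of \<open>(t, k g)\<close>.
\<close>

definition colim_post ::
  "('o, 'm, 'z) category_scheme \<Rightarrow> ('i, 'a, 'o, 'm) diagram \<Rightarrow> 'm \<Rightarrow>
   ('i \<times> 'm) set \<Rightarrow> ('i \<times> 'm) set" where
  "colim_post C X k c = (\<Union>(t, g) \<in> c. colim_rel C X (Cod C k) `` {(t, k \<cdot>\<^bsub>C\<^esub> g)})"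

text \<open>
  Index categories have objects in \<open>'v\<close> and arrows in \<open>'v \<times> 'v\<close>. Since these types have the same
  cardinality, every small category is isomorphic to one of this kind; arrows are taken in
  \<open>'v \<times> 'v\<close> so that partially ordered subsets of \<open>'v\<close> are themselves index categories.
\<close>

type_synonym ('v, 'o, 'm) pro_object = "('v, 'v \<times> 'v, 'o, 'm) diagram"

type_synonym ('v, 'o, 'm) pro_arrow =
  "('v, 'o, 'm) pro_object \<times> ('v, 'o, 'm) pro_object \<times> ('v \<Rightarrow> ('v \<times> 'm) set)"

definition pro_objects ::
  "'v itself \<Rightarrow> ('o, 'm, 'z) category_scheme \<Rightarrow> ('v, 'o, 'm) pro_object set" where
  "pro_objects V C = {X. cofiltered V (Shape X) \<and> is_functor C X}"

text \<open>\<open>lim_s colim_t Hom(X_t, Y_s)\<close>, as a set of compatible families.\<close>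

definition pro_Hom ::
  "('o, 'm, 'z) category_scheme \<Rightarrow> ('v, 'o, 'm) pro_object \<Rightarrow> ('v, 'o, 'm) pro_object \<Rightarrow>
   ('v \<Rightarrow> ('v \<times> 'm) set) set" where
  "pro_Hom C X Y =
     {\<phi> \<in> (\<Pi>\<^sub>E s \<in> Obj (Shape Y). colim_Hom C X (ObM Y s)).
        \<forall>b \<in> Arr (Shape Y).
          colim_post C X (ArM Y b) (\<phi> (Dom (Shape Y) b)) = \<phi> (Cod (Shape Y) b)}"

text \<open>If \<open>\<psi> u\<close> is the class of \<open>(s, h)\<close>, then the composite has the component \<open>h \<cdot> \<phi> s\<close> at \<open>u\<close>.\<close>

definition pro_comp ::
  "('o, 'm, 'z) category_scheme \<Rightarrow> ('v, 'o, 'm) pro_arrow \<Rightarrow> ('v, 'o, 'm) pro_arrow \<Rightarrow>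
   ('v, 'o, 'm) pro_arrow" where
  "pro_comp C = (\<lambda>(Y', Z, \<psi>) (X, Y, \<phi>).
     (X, Z, \<lambda>u \<in> Obj (Shape Z). \<Union>(s, h) \<in> \<psi> u. colim_post C X h (\<phi> s)))"

text \<open>The map of pro-objects induced by a natural transformation of diagrams of the same shape.\<close>

definition pro_of_nat ::
  "('o, 'm, 'z) category_scheme \<Rightarrow> ('v, 'o, 'm) pro_object \<Rightarrow> ('v, 'o, 'm) pro_object \<Rightarrow>
   ('v \<Rightarrow> 'm) \<Rightarrow> ('v, 'o, 'm) pro_arrow" where
  "pro_of_nat C X Y \<tau> =
     (X, Y, \<lambda>s \<in> Obj (Shape Y). colim_rel C X (ObM Y s) `` {(s, \<tau> s)})"

definition pro_category ::
  "'v itself \<Rightarrow> ('o, 'm, 'z) category_scheme \<Rightarrow>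
   (('v, 'o, 'm) pro_object, ('v, 'o, 'm) pro_arrow) category" where
  "pro_category V C =
     \<lparr>Obj = pro_objects V C,
      Arr = {(X, Y, \<phi>). X \<in> pro_objects V C \<and> Y \<in> pro_objects V C \<and> \<phi> \<in> pro_Hom C X Y},
      Dom = (\<lambda>(X, Y, \<phi>). X),
      Cod = (\<lambda>(X, Y, \<phi>). Y),
      Ident = (\<lambda>X. pro_of_nat C X X (\<lambda>s. Ident C (ObM X s))),
      Comp = pro_comp C\<rparr>"

definition level_representation ::
  "'v itself \<Rightarrow> ('o, 'm, 'z) category_scheme \<Rightarrow> ('v, 'o, 'm) pro_arrow \<Rightarrow>
   ('v, 'o, 'm) pro_object \<Rightarrow> ('v, 'o, 'm) pro_object \<Rightarrow> ('v \<Rightarrow> 'm) \<Rightarrow> bool" where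
  "level_representation V C f X' Y' \<tau> \<longleftrightarrow>
     (let P = pro_category V C in
        f \<in> Arr P \<and> X' \<in> Obj P \<and> Y' \<in> Obj P \<and> natural_transformation C X' Y' \<tau> \<and>
        (\<exists>a b. a \<in> Hom P (Dom P f) X' \<and> iso_in P a \<and>
               b \<in> Hom P (Cod P f) Y' \<and> iso_in P b \<and>
               b \<cdot>\<^bsub>P\<^esub> f = pro_of_nat C X' Y' \<tau> \<cdot>\<^bsub>P\<^esub> a))"

definition essentially_levelwise ::
  "'v itself \<Rightarrow> ('o, 'm, 'z) category_scheme \<Rightarrow> 'm set \<Rightarrow> ('v, 'o, 'm) pro_arrow \<Rightarrow> bool" where
  "essentially_levelwise V C Q f \<longleftrightarrow>
     (\<exists>X' Y' \<tau>. level_representation V C f X' Y' \<tau> \<and> (\<forall>s \<in> Obj (Shape X'). \<tau> s \<in> Q))"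

definition directed_set :: "'i rel \<Rightarrow> bool" where
  "directed_set r \<longleftrightarrow>
     partial_order_on (Field r) r \<and> Field r \<noteq> {} \<and>
     (\<forall>s \<in> Field r. \<forall>t \<in> Field r. \<exists>u. (s, u) \<in> r \<and> (t, u) \<in> r)"

definition cofinite_order :: "'i rel \<Rightarrow> bool" where
  "cofinite_order r \<longleftrightarrow> (\<forall>t \<in> Field r. finite {s. (s, t) \<in> r})"

text \<open>
  \<open>m\<close> is the relative matching map \<open>X_t \<rightarrow> (lim_{s<t} X_s) \<times>_{lim_{s<t} Y_s} Y_t\<close> of \<open>\<tau>\<close>,
  for some choice of the limits and of the pullback \<open>P\<close>.
\<close>

definition is_relative_matching_map ::
  "('o, 'm, 'z) category_scheme \<Rightarrow> 'i rel \<Rightarrow>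
   ('i, 'i \<times> 'i, 'o, 'm) diagram \<Rightarrow> ('i, 'i \<times> 'i, 'o, 'm) diagram \<Rightarrow> ('i \<Rightarrow> 'm) \<Rightarrow>
   'i \<Rightarrow> 'm \<Rightarrow> bool" where
  "is_relative_matching_map C r X Y \<tau> t m \<longleftrightarrow>
     (\<exists>LX \<pi>X LY \<pi>Y l e P p q.
        limit_cone C (restrict_below r t X) LX \<pi>X \<and>
        limit_cone C (restrict_below r t Y) LY \<pi>Y \<and>
        l \<in> Hom C LX LY \<and> (\<forall>s \<in> underS r t. \<pi>Y s \<cdot>\<^bsub>C\<^esub> l = \<tau> s \<cdot>\<^bsub>C\<^esub> \<pi>X s) \<and>
        e \<in> Hom C (ObM Y t) LY \<and> (\<forall>s \<in> underS r t. \<pi>Y s \<cdot>\<^bsub>C\<^esub> e = ArM Y (t, s)) \<and>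
        pullback_square C l e P p q \<and>
        m \<in> Hom C (ObM X t) P \<and>
        (\<forall>s \<in> underS r t. \<pi>X s \<cdot>\<^bsub>C\<^esub> (p \<cdot>\<^bsub>C\<^esub> m) = ArM X (t, s)) \<and>
        q \<cdot>\<^bsub>C\<^esub> m = \<tau> t)"


section \<open>The strict model structure\<close>

record ('o, 'm) model_category = "('o, 'm) category" +
  WEq :: "'m set"
  Cofib :: "'m set"
  Fib :: "'m set"

definition special_fibration ::
  "'v itself \<Rightarrow> ('o, 'm, 'z) model_category_scheme \<Rightarrow> ('v, 'o, 'm) pro_arrow \<Rightarrow> bool" where
  "special_fibration V C f \<longleftrightarrow>
     (\<exists>r X' Y' \<tau>.
        directed_set r \<and> cofinite_order r \<and> Shape X' = poset_category r \<and>
        level_representation V C f X' Y' \<tau> \<and>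
        (\<forall>t \<in> Field r. \<exists>m. is_relative_matching_map C r X' Y' \<tau> t m \<and> m \<in> Fib C))"

definition strict_pro ::
  "'v itself \<Rightarrow> ('o, 'm, 'z) model_category_scheme \<Rightarrow>
   (('v, 'o, 'm) pro_object, ('v, 'o, 'm) pro_arrow) model_category" where
  "strict_pro V C =
     category.extend (pro_category V C)
       \<lparr>WEq = {f \<in> Arr (pro_category V C). essentially_levelwise V C (WEq C) f},
        Cofib = {f \<in> Arr (pro_category V C). essentially_levelwise V C (Cofib C) f},
        Fib = {f \<in> Arr (pro_category V C).
                 \<exists>g. special_fibration V C g \<and> is_retract_of_arrow (pro_category V C) f g}\<rparr>"


section \<open>Fibrantly generated model categories\<close>

text \<open>
  A small ordinal is represented by a well-order \<open>r\<close> on a small subset \<open>Field r\<close> of \<open>'v\<close>.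
\<close>

definition is_successor :: "'i rel \<Rightarrow> 'i \<Rightarrow> 'i \<Rightarrow> bool" where
  "is_successor r \<alpha> \<beta> \<longleftrightarrow> \<alpha> \<in> underS r \<beta> \<and> underS r \<beta> = under r \<alpha>"

definition is_limit_point :: "'i rel \<Rightarrow> 'i \<Rightarrow> bool" where
  "is_limit_point r \<beta> \<longleftrightarrow>
     \<beta> \<in> Field r \<and> underS r \<beta> \<noteq> {} \<and> (\<forall>\<alpha> \<in> underS r \<beta>. \<exists>\<gamma> \<in> underS r \<beta>. \<alpha> \<in> underS r \<gamma>)"

definition is_tower ::
  "'v itself \<Rightarrow> ('o, 'm, 'z) category_scheme \<Rightarrow> 'v rel \<Rightarrow> ('v, 'v \<times> 'v, 'o, 'm) diagram \<Rightarrow> bool"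
where
  "is_tower V C r Z \<longleftrightarrow>
     Well_order r \<and> small V (Field r) \<and> Shape Z = poset_category r \<and> is_functor C Z \<and>
     (\<forall>\<beta>. is_limit_point r \<beta> \<longrightarrow>
        limit_cone C (restrict_below r \<beta> Z) (ObM Z \<beta>) (\<lambda>\<alpha>. ArM Z (\<beta>, \<alpha>)))"

definition is_cocell_complex ::
  "'v itself \<Rightarrow> ('o, 'm, 'z) category_scheme \<Rightarrow> 'm set \<Rightarrow> 'm \<Rightarrow> bool" where
  "is_cocell_complex V C D f \<longleftrightarrow>
     (\<exists>r Z L \<pi> \<zeta>.
        is_tower V C r Z \<and>
        (\<forall>\<alpha> \<beta>. is_successor r \<alpha> \<beta> \<longrightarrow> (\<exists>d \<in> D. is_base_change C d (ArM Z (\<beta>, \<alpha>)))) \<and>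
        limit_cone C Z L \<pi> \<and>
        \<zeta> \<in> Field r \<and> underS r \<zeta> = {} \<and>
        isomorphic_arrows C f (\<pi> \<zeta>))"

text \<open>
  The map \<open>colim_\<beta> Hom(Z_\<beta>, W) \<rightarrow> Hom(L, W)\<close> induced by a cone with apex \<open>L\<close>: all elements \<open>(\<beta>, g)\<close>
  of a class have the same composite \<open>g \<cdot> \<pi>_\<beta>\<close>, which is the value of the map.
\<close>

definition colim_to_Hom ::
  "('o, 'm, 'z) category_scheme \<Rightarrow> ('i \<Rightarrow> 'm) \<Rightarrow> ('i \<times> 'm) set \<Rightarrow> 'm" where
  "colim_to_Hom C \<pi> c = the_elem ((\<lambda>(\<beta>, g). g \<cdot>\<^bsub>C\<^esub> \<pi> \<beta>) ` c)"

definition cosmall ::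
  "'v itself \<Rightarrow> ('o, 'm, 'z) category_scheme \<Rightarrow> 'm set \<Rightarrow> 'o \<Rightarrow> bool" where
  "cosmall V C D W \<longleftrightarrow>
     (\<exists>\<kappa> :: 'v rel. Card_order \<kappa> \<and> small V (Field \<kappa>) \<and>
        (\<forall>r :: 'v rel. \<forall>Z L \<pi>.
           Card_order r \<longrightarrow> cinfinite r \<longrightarrow> regularCard r \<longrightarrow> \<kappa> \<le>o r \<longrightarrow>
           is_tower V C r Z \<longrightarrow>
           (\<forall>\<alpha> \<beta>. is_successor r \<alpha> \<beta> \<longrightarrow> is_cocell_complex V C D (ArM Z (\<beta>, \<alpha>))) \<longrightarrow>
           limit_cone C Z L \<pi> \<longrightarrow>
           bij_betw (colim_to_Hom C \<pi>) (colim_Hom C Z W) (Hom C L W)))"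

definition fibrantly_generated ::
  "'v itself \<Rightarrow> ('o, 'm, 'z) model_category_scheme \<Rightarrow> bool" where
  "fibrantly_generated V M \<longleftrightarrow>
     (\<exists>I J. I \<subseteq> Arr M \<and> J \<subseteq> Arr M \<and> small V I \<and> small V J \<and>
        (\<forall>p \<in> I. cosmall V M I (Cod M p)) \<and>
        (\<forall>p \<in> J. cosmall V M J (Cod M p)) \<and>
        (\<forall>f \<in> Arr M. f \<in> WEq M \<inter> Cofib M \<longleftrightarrow> (\<forall>p \<in> I. has_left_lifting M f p)) \<and>
        (\<forall>f \<in> Arr M. f \<in> Cofib M \<longleftrightarrow> (\<forall>p \<in> J. has_left_lifting M f p)))"


section \<open>Simplicial sets\<close>

definition set_category :: "'v itself \<Rightarrow> ('v set, 'v set \<times> 'v set \<times> ('v \<Rightarrow> 'v)) category" where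
  "set_category V =
     \<lparr>Obj = {A. small V A},
      Arr = {(A, B, f). small V A \<and> small V B \<and> f \<in> A \<rightarrow>\<^sub>E B},
      Dom = (\<lambda>(A, B, f). A),
      Cod = (\<lambda>(A, B, f). B),
      Ident = (\<lambda>A. (A, A, \<lambda>x \<in> A. x)),
      Comp = (\<lambda>(B', E, g) (A, B, f). (A, E, compose A g f))\<rparr>"

text \<open>The simplex category; the object \<open>n\<close> is the ordered set \<open>{0, ..., n}\<close>.\<close>

definition simplex_category :: "(nat, nat \<times> nat \<times> (nat \<Rightarrow> nat)) category" where
  "simplex_category =
     \<lparr>Obj = UNIV,
      Arr = {(m, n, \<theta>). \<theta> \<in> {..m} \<rightarrow>\<^sub>E {..n} \<and> mono_on {..m} \<theta>},
      Dom = (\<lambda>(m, n, \<theta>). m),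
      Cod = (\<lambda>(m, n, \<theta>). n),
      Ident = (\<lambda>n. (n, n, \<lambda>i \<in> {..n}. i)),
      Comp = (\<lambda>(n', k, \<eta>) (m, n, \<theta>). (m, k, compose {..m} \<eta> \<theta>))\<rparr>"

type_synonym 'v sset =
  "(nat, nat \<times> nat \<times> (nat \<Rightarrow> nat), 'v set, 'v set \<times> 'v set \<times> ('v \<Rightarrow> 'v)) diagram"

type_synonym 'v sset_map =
  "'v sset \<times> 'v sset \<times> (nat \<Rightarrow> 'v set \<times> 'v set \<times> ('v \<Rightarrow> 'v))"

definition sset_category :: "'v itself \<Rightarrow> ('v sset, 'v sset_map) category" where
  "sset_category V = functor_category (op_category simplex_category) (set_category V)"

text \<open>For \<open>\<theta> : [m] \<rightarrow> [n]\<close>, the operator \<open>sset_op X (m, n, \<theta>)\<close> maps \<open>X_n\<close> to \<open>X_m\<close>.\<close>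

definition sset_op :: "'v sset \<Rightarrow> nat \<times> nat \<times> (nat \<Rightarrow> nat) \<Rightarrow> 'v \<Rightarrow> 'v" where
  "sset_op X a = snd (snd (ArM X a))"

definition sset_apply :: "'v sset_map \<Rightarrow> nat \<Rightarrow> 'v \<Rightarrow> 'v" where
  "sset_apply f n = snd (snd (snd (snd f) n))"

text \<open>The face operator \<open>d_i : X_n \<rightarrow> X_{n-1}\<close>, for \<open>n \<ge> 1\<close>.\<close>

definition sset_face :: "'v sset \<Rightarrow> nat \<Rightarrow> nat \<Rightarrow> 'v \<Rightarrow> 'v" where
  "sset_face X n i = sset_op X (n - 1, n, \<lambda>j \<in> {..n - 1}. if j < i then j else Suc j)"

text \<open>
  Every horn in \<open>X\<close> of dimension \<open>n + 1\<close> over a simplex \<open>y\<close> of \<open>Y\<close> has a filler over \<open>y\<close>. A map from the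
  horn (with the \<open>k\<close>-th face missing) to \<open>X\<close> is a family of \<open>n\<close>-simplices \<open>x i\<close>, \<open>i \<noteq> k\<close>, with
  \<open>d_i (x j) = d_{j-1} (x i)\<close> for \<open>i < j\<close>; for \<open>n = 0\<close> there is no such pair \<open>i < j\<close>.
\<close>

definition Kan_fibration :: "'v itself \<Rightarrow> 'v sset_map \<Rightarrow> bool" where
  "Kan_fibration V p \<longleftrightarrow>
     p \<in> Arr (sset_category V) \<and>
     (let X = Dom (sset_category V) p; Y = Cod (sset_category V) p in
        \<forall>n. \<forall>k \<le> Suc n. \<forall>x. \<forall>y \<in> ObM Y (Suc n).
          (\<forall>i \<in> {..Suc n} - {k}. x i \<in> ObM X n \<and> sset_apply p n (x i) = sset_face Y (Suc n) i y) \<longrightarrow>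
          (\<forall>i \<in> {..Suc n} - {k}. \<forall>j \<in> {..Suc n} - {k}. i < j \<longrightarrow>
             sset_face X n i (x j) = sset_face X n (j - 1) (x i)) \<longrightarrow>
          (\<exists>z \<in> ObM X (Suc n). sset_apply p (Suc n) z = y \<and>
             (\<forall>i \<in> {..Suc n} - {k}. sset_face X (Suc n) i z = x i)))"


subsection \<open>Geometric realization and weak homotopy equivalences\<close>

text \<open>\<open>((n, x), t)\<close> is the point \<open>t\<close> of the copy of the standard \<open>n\<close>-simplex indexed by \<open>x \<in> X_n\<close>.\<close>

type_synonym 'v cell_point = "(nat \<times> 'v) \<times> (nat \<Rightarrow> real)"

definition cell_space :: "'v sset \<Rightarrow> 'v cell_point topology" where
  "cell_space X =
     sum_topology (\<lambda>(n, x). subtopology (powertop_real UNIV) (standard_simplex n))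
       (SIGMA n : UNIV. ObM X n)"

text \<open>The affine map of standard simplices induced by \<open>\<theta> : [m] \<rightarrow> [n]\<close>.\<close>

definition simplex_push :: "nat \<Rightarrow> (nat \<Rightarrow> nat) \<Rightarrow> (nat \<Rightarrow> real) \<Rightarrow> nat \<Rightarrow> real" where
  "simplex_push m \<theta> t = (\<lambda>j. \<Sum>i | i \<le> m \<and> \<theta> i = j. t i)"

definition cell_glue :: "'v sset \<Rightarrow> 'v cell_point rel" where
  "cell_glue X =
     {(((m, sset_op X (m, n, \<theta>) x), t), ((n, x), simplex_push m \<theta> t)) | m n \<theta> x t.
        (m, n, \<theta>) \<in> Arr simplex_category \<and> x \<in> ObM X n \<and> t \<in> standard_simplex m}"

definition cell_class :: "'v sset \<Rightarrow> 'v cell_point \<Rightarrow> 'v cell_point set" where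
  "cell_class X a = (cell_glue X \<union> (cell_glue X)\<inverse>)\<^sup>* `` {a}"

text \<open>The quotient topology on the set of classes.\<close>

definition realization :: "'v sset \<Rightarrow> 'v cell_point set topology" where
  "realization X =
     topology (\<lambda>U. U \<subseteq> cell_class X ` topspace (cell_space X) \<and>
                   openin (cell_space X) {a \<in> topspace (cell_space X). cell_class X a \<in> U})"

lemma istopology_realization:
  "istopology (\<lambda>U. U \<subseteq> cell_class X ` topspace (cell_space X) \<and>
                   openin (cell_space X) {a \<in> topspace (cell_space X). cell_class X a \<in> U})"
proof -
  have Int: "{a \<in> T. c a \<in> U \<inter> W} = {a \<in> T. c a \<in> U} \<inter> {a \<in> T. c a \<in> W}"
    and Un: "{a \<in> T. c a \<in> \<Union>K} = (\<Union>U \<in> K. {a \<in> T. c a \<in> U})"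
    for T :: "'x set" and c :: "'x \<Rightarrow> 'y" and U W K
    by auto
  show ?thesis
    unfolding istopology_def Int Un by (auto intro!: openin_Union)
qed

text \<open>The class of \<open>((n, x), t)\<close> goes to the class of \<open>((n, f x), t)\<close>.\<close>

definition realization_map :: "'v sset_map \<Rightarrow> 'v cell_point set \<Rightarrow> 'v cell_point set" where
  "realization_map f c =
     (\<Union>((n, x), t) \<in> c. cell_class (fst (snd f)) ((n, sset_apply f n x), t))"

text \<open>
  The set \<open>\<pi>_n(T, x)\<close> as the set of pointed homotopy classes of maps from the pointed \<open>n\<close>-sphere.
  For \<open>n = 0\<close> the sphere consists of two points, and \<open>\<pi>_0(T, x)\<close> is the set of path components.
\<close>

definition sphere_base :: "nat \<Rightarrow> real" where
  "sphere_base = (\<lambda>i. if i = 0 then 1 else 0)"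

definition sphere_maps :: "nat \<Rightarrow> 'a topology \<Rightarrow> 'a \<Rightarrow> ((nat \<Rightarrow> real) \<Rightarrow> 'a) set" where
  "sphere_maps n T x = {\<gamma>. continuous_map (nsphere n) T \<gamma> \<and> \<gamma> sphere_base = x}"

definition sphere_homotopy ::
  "nat \<Rightarrow> 'a topology \<Rightarrow> 'a \<Rightarrow> ((nat \<Rightarrow> real) \<Rightarrow> 'a) rel" where
  "sphere_homotopy n T x =
     {(\<gamma>, \<delta>). homotopic_with (\<lambda>h. h sphere_base = x) (nsphere n) T \<gamma> \<delta>}"

definition homotopy_set ::
  "nat \<Rightarrow> 'a topology \<Rightarrow> 'a \<Rightarrow> ((nat \<Rightarrow> real) \<Rightarrow> 'a) set set" where
  "homotopy_set n T x = sphere_maps n T x // sphere_homotopy n T x"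

definition homotopy_set_map ::
  "nat \<Rightarrow> 'b topology \<Rightarrow> 'b \<Rightarrow> ('a \<Rightarrow> 'b) \<Rightarrow>
   ((nat \<Rightarrow> real) \<Rightarrow> 'a) set \<Rightarrow> ((nat \<Rightarrow> real) \<Rightarrow> 'b) set" where
  "homotopy_set_map n T' y g c = (\<Union>\<gamma> \<in> c. sphere_homotopy n T' y `` {g \<circ> \<gamma>})"

text \<open>
  For \<open>n \<ge> 1\<close> the map on homotopy groups is a homomorphism, so it is an isomorphism if and only if it
  is bijective.
\<close>

definition weak_homotopy_equivalence_top ::
  "'a topology \<Rightarrow> 'b topology \<Rightarrow> ('a \<Rightarrow> 'b) \<Rightarrow> bool" where
  "weak_homotopy_equivalence_top T T' g \<longleftrightarrow>
     continuous_map T T' g \<and>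
     (topspace T = {} \<longrightarrow> topspace T' = {}) \<and>
     (\<forall>n. \<forall>x \<in> topspace T.
        bij_betw (homotopy_set_map n T' (g x) g) (homotopy_set n T x) (homotopy_set n T' (g x)))"

definition weak_homotopy_equivalence :: "'v itself \<Rightarrow> 'v sset_map \<Rightarrow> bool" where
  "weak_homotopy_equivalence V f \<longleftrightarrow>
     f \<in> Arr (sset_category V) \<and>
     weak_homotopy_equivalence_top
       (realization (Dom (sset_category V) f)) (realization (Cod (sset_category V) f))
       (realization_map f)"

definition sset_model :: "'v itself \<Rightarrow> ('v sset, 'v sset_map) model_category" where
  "sset_model V =
     category.extend (sset_category V)
       \<lparr>WEq = {f. weak_homotopy_equivalence V f},
        Cofib = {f. monic_in (sset_category V) f},
        Fib = {f. Kan_fibration V f}\<rparr>"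

end

theory Submission
  imports Defs
begin

text \<open>
  Only the generating acyclic fibrations \<open>J\<close> matter. Choose a set \<open>A\<close> which is larger than the product
  of the vertex sets \<open>(E_s)_0\<close> for every map \<open>E \<rightarrow> B\<close> in \<open>J\<close>, and let \<open>f\<close> be the map from the constant
  pro-object on the discrete simplicial set \<open>A\<close> to the pro-object of all quotients of \<open>A\<close> of cardinality
  less than that of \<open>A\<close>. A map from \<open>A\<close> to such an \<open>E\<close> factors through one of these quotients, which
  gives a lift since \<open>f\<close> is an epimorphism; so \<open>f\<close> would be a cofibration. But if \<open>f\<close> were essentially a
  levelwise monomorphism, then some projection \<open>q : A \<rightarrow> Q\<close> onto a quotient would be monic.
  Quotients are represented by idempotents of \<open>A\<close>, so that \<open>q\<close> has a section \<open>i\<close> and the idempotent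
  \<open>i q\<close> would be the identity, contradicting the cardinality of \<open>Q\<close>.
\<close>

section \<open>Small sets\<close>

text \<open>The quotients face two opposite demands. Every map from \<open>A\<close> to the domain
  of a member of \<open>J\<close> must factor through one of them; the bound concerns the product
  over all levels \<open>s\<close> because one quotient has to serve all components of a map of
  pro-objects at once. On the other hand, no quotient may be \<open>A\<close> itself. The cutoff
  strictly below \<open>|A|\<close> meets both, and for infinite \<open>A\<close> it keeps the
  system directed, since two such quotients have fewer than \<open>|A|\<close> pairs of classes.
  That \<open>J\<close> is a set gives one small \<open>A\<close> that works for all its members.

  Sections replace reasoning about injective or surjective maps of pro-objects: equations are
  cancelled by composing with sections, and of a levelwise monomorphism only left cancellation in
  the base category is used. The part on lifting and monomorphisms thus runs in an arbitrary
  category (\<open>split_idempotents\<close>); simplicial sets enter through maps out of discrete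
  objects, which amount to functions to vertex sets.\<close>

lemma card_of_Times_less:
  assumes "infinite C" "|A| <o |C|" "|B| <o |C|"
  shows "|A \<times> B| <o |C|"
proof -
  consider "finite A" "finite B" | "infinite A" "|B| \<le>o |A|" | "infinite B" "|A| \<le>o |B|"
    using ordLeq_total[OF card_of_Well_order[of A] card_of_Well_order[of B]]
      card_of_ordLeq_infinite[of A B] card_of_ordLeq_infinite[of B A] by argo
  then show ?thesis
  proof cases
    case 1
    then show ?thesis
      using assms(1) by (intro finite_ordLess_infinite2 finite_cartesian_product)
  next
    case 2
    show ?thesis
    proof (cases "B = {}")
      case True
      then show ?thesis using assms by (simp add: card_of_empty4)
    next
      case False
      then show ?thesis
        using card_of_Times_infinite[OF 2(1) False 2(2)] assms(2) ordIso_ordLess_trans by blast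
    qed
  next
    case 3
    show ?thesis
    proof (cases "A = {}")
      case True
      then show ?thesis using assms by (simp add: card_of_empty4)
    next
      case False
      then show ?thesis
        using card_of_Times_infinite[OF 3(1) False 3(2)] assms(3) ordIso_ordLess_trans by blast
    qed
  qed
qed

lemma small_le: "small V B \<Longrightarrow> |A| \<le>o |B| \<Longrightarrow> small V A"
  unfolding small_def by (rule ordLeq_ordLess_trans)

lemma small_subset: "small V B \<Longrightarrow> A \<subseteq> B \<Longrightarrow> small V A"
  by (meson card_of_mono1 small_le)

lemma small_image: "small V A \<Longrightarrow> small V (f ` A)"
  using card_of_image small_le by blast

text \<open>Indices of pro-objects and simplices must be elements of \<open>'v\<close>, whereas the
  small sets built below have other types; they are moved into \<open>'v\<close> by this
  lemma.\<close>

lemma small_copy: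
  fixes A :: "'a set"
  assumes "small (V :: 'v itself) A"
  obtains T :: "'v set" and enc where "bij_betw enc T A"
proof -
  have "|A| \<le>o |UNIV :: 'v set|"
    using assms unfolding small_def by (rule ordLess_imp_ordLeq)
  then obtain f where "f ` A \<subseteq> (UNIV :: 'v set)" "inj_on f A"
    unfolding card_of_ordLeq[symmetric] by blast
  then have "bij_betw (inv_into A f) (f ` A) A"
    by (simp add: bij_betw_inv_into inj_on_imp_bij_betw)
  then show thesis ..
qed

section \<open>Closure properties of small sets\<close>

context
  fixes V :: "'v itself"
  assumes V: "inaccessible_universe V"
begin

lemma infinite_universe: "infinite (UNIV :: 'v set)"
  using V unfolding inaccessible_universe_def
  by (metis Field_natLeq card_of_mono2 card_of_ordLeq_finite card_of_UNIV infinite_UNIV_nat ordLess_imp_ordLeq Field_card_of)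

lemma small_nat: "small V (UNIV :: nat set)"
  using V card_of_nat ordIso_ordLess_trans unfolding inaccessible_universe_def small_def by blast

lemma small_Times: "small V A \<Longrightarrow> small V B \<Longrightarrow> small V (A \<times> B)"
  unfolding small_def by (rule card_of_Times_less[OF infinite_universe])

text \<open>The strong limit property of the universe speaks of subsets of \<open>'v\<close>; it is
  transported along a copy.\<close>

lemma small_Pow:
  assumes "small V A"
  shows "small V (Pow A)"
proof -
  obtain T :: "'v set" and f where f: "bij_betw f T A"
    using small_copy assms .
  then have "small V T"
    using assms small_le card_of_ordIsoI ordIso_imp_ordLeq by blast
  then have "small V (Pow T)"
    using V unfolding inaccessible_universe_def by blast
  then show ?thesis
    using small_image[of V "Pow T" "image f"] f by (simp add: bij_betw_def image_Pow_surj)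
qed

text \<open>This is regularity of the cardinality of \<open>'v\<close>, in the equivalent form of
  stability under small sums.\<close>

lemma small_Sigma:
  assumes "small V A" "\<And>a. a \<in> A \<Longrightarrow> small V (F a)"
  shows "small V (Sigma A F)"
  using V infinite_universe assms unfolding inaccessible_universe_def small_def
  by (intro stable_elim regularCard_stable) auto

lemma small_UNION:
  assumes "small V A" "\<And>a. a \<in> A \<Longrightarrow> small V (F a)"
  shows "small V (\<Union>a\<in>A. F a)"
  by (rule small_le[OF small_Sigma[OF assms] card_of_UNION_Sigma])

text \<open>An extensional function is determined by its graph, which is a subset of a small
  product.\<close>

lemma small_PiE:
  assumes "small V A" "\<And>a. a \<in> A \<Longrightarrow> small V (F a)"
  shows "small V (PiE A F)"
proof -
  have "inj_on (\<lambda>f. (\<lambda>a. (a, f a)) ` A) (PiE A F)"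
    by (rule inj_onI, rule PiE_ext) auto
  moreover have "(\<lambda>f. (\<lambda>a. (a, f a)) ` A) ` PiE A F \<subseteq> Pow (A \<times> (\<Union>a\<in>A. F a))"
    by (auto simp: PiE_iff)
  ultimately have "|PiE A F| \<le>o |Pow (A \<times> (\<Union>a\<in>A. F a))|"
    by (intro card_of_ordLeqI[of "\<lambda>f. (\<lambda>a. (a, f a)) ` A"]) auto
  then show ?thesis
    by (rule small_le[rotated]) (intro small_Pow small_Times small_UNION assms)
qed

end

section \<open>Composition of maps of pro-objects\<close>

context
  fixes C :: "('o, 'm, 'z) category_scheme"
  assumes C: "is_category C"
begin

lemma comp_in_Hom:
  assumes "g \<in> Hom C y z" "f \<in> Hom C x y"
  shows "g \<cdot>\<^bsub>C\<^esub> f \<in> Hom C x z"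
proof -
  have "\<forall>f \<in> Arr C. \<forall>g \<in> Arr C. Dom C g = Cod C f \<longrightarrow> g \<cdot>\<^bsub>C\<^esub> f \<in> Hom C (Dom C f) (Cod C g)"
    using C unfolding is_category_def by (elim conjE)
  then show ?thesis
    using assms by (simp add: Hom_def)
qed

lemma ident_in_Hom: "x \<in> Obj C \<Longrightarrow> Ident C x \<in> Hom C x x"
  using C unfolding is_category_def by (elim conjE) (rule bspec)

lemma comp_ident: "f \<in> Hom C x y \<Longrightarrow> f \<cdot>\<^bsub>C\<^esub> Ident C x = f"
  and ident_comp: "f \<in> Hom C x y \<Longrightarrow> Ident C y \<cdot>\<^bsub>C\<^esub> f = f"
proof -
  have *: "\<forall>f \<in> Arr C. f \<cdot>\<^bsub>C\<^esub> Ident C (Dom C f) = f \<and> Ident C (Cod C f) \<cdot>\<^bsub>C\<^esub> f = f"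
    using C unfolding is_category_def by (elim conjE)
  show "f \<in> Hom C x y \<Longrightarrow> f \<cdot>\<^bsub>C\<^esub> Ident C x = f"
    and "f \<in> Hom C x y \<Longrightarrow> Ident C y \<cdot>\<^bsub>C\<^esub> f = f"
    using * by (auto simp: Hom_def)
qed

lemma comp_assoc:
  assumes "f \<in> Hom C w x" "g \<in> Hom C x y" "h \<in> Hom C y z"
  shows "(h \<cdot>\<^bsub>C\<^esub> g) \<cdot>\<^bsub>C\<^esub> f = h \<cdot>\<^bsub>C\<^esub> (g \<cdot>\<^bsub>C\<^esub> f)"
proof -
  have "\<forall>f \<in> Arr C. \<forall>g \<in> Arr C. \<forall>h \<in> Arr C. Dom C g = Cod C f \<longrightarrow> Dom C h = Cod C g \<longrightarrow>
      h \<cdot>\<^bsub>C\<^esub> (g \<cdot>\<^bsub>C\<^esub> f) = (h \<cdot>\<^bsub>C\<^esub> g) \<cdot>\<^bsub>C\<^esub> f"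
    using C unfolding is_category_def by (elim conjE)
  then show ?thesis
    using assms by (simp add: Hom_def)
qed

lemma Dom_in_Obj: "f \<in> Hom C x y \<Longrightarrow> x \<in> Obj C"
  and Cod_in_Obj: "f \<in> Hom C x y \<Longrightarrow> y \<in> Obj C"
proof -
  have *: "\<forall>f \<in> Arr C. Dom C f \<in> Obj C \<and> Cod C f \<in> Obj C"
    using C unfolding is_category_def by (elim conjE)
  show "f \<in> Hom C x y \<Longrightarrow> x \<in> Obj C" and "f \<in> Hom C x y \<Longrightarrow> y \<in> Obj C"
    using * by (auto simp: Hom_def)
qed

end

lemma functor_Obj: "is_functor C X \<Longrightarrow> s \<in> Obj (Shape X) \<Longrightarrow> ObM X s \<in> Obj C"
  by (simp add: is_functor_def)

lemma functor_Hom: "is_functor C X \<Longrightarrow> a \<in> Hom (Shape X) s t \<Longrightarrow> ArM X a \<in> Hom C (ObM X s) (ObM X t)"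
  by (auto simp: is_functor_def Hom_def)

lemma functor_comp:
  "is_functor C X \<Longrightarrow> a \<in> Hom (Shape X) s t \<Longrightarrow> b \<in> Hom (Shape X) t u \<Longrightarrow>
   ArM X (b \<cdot>\<^bsub>Shape X\<^esub> a) = ArM X b \<cdot>\<^bsub>C\<^esub> ArM X a"
  by (auto simp: is_functor_def Hom_def)

lemma functor_ident: "is_functor C X \<Longrightarrow> s \<in> Obj (Shape X) \<Longrightarrow> ArM X (Ident (Shape X) s) = Ident C (ObM X s)"
  by (simp add: is_functor_def)

lemma colim_relI:
  assumes "t \<in> Obj (Shape X)" "t' \<in> Obj (Shape X)" "u \<in> Obj (Shape X)"
    "g \<in> Hom C (ObM X t) W" "g' \<in> Hom C (ObM X t') W"
    "a \<in> Hom (Shape X) u t" "b \<in> Hom (Shape X) u t'"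
    "g \<cdot>\<^bsub>C\<^esub> ArM X a = g' \<cdot>\<^bsub>C\<^esub> ArM X b"
  shows "((t, g), (t', g')) \<in> colim_rel C X W"
  using assms unfolding colim_rel_def colim_carrier_def by blast

lemma colim_relE:
  assumes "((t, g), (t', g')) \<in> colim_rel C X W"
  obtains u a b where "t \<in> Obj (Shape X)" "t' \<in> Obj (Shape X)" "u \<in> Obj (Shape X)"
    "g \<in> Hom C (ObM X t) W" "g' \<in> Hom C (ObM X t') W"
    "a \<in> Hom (Shape X) u t" "b \<in> Hom (Shape X) u t'"
    "g \<cdot>\<^bsub>C\<^esub> ArM X a = g' \<cdot>\<^bsub>C\<^esub> ArM X b"
  using assms unfolding colim_rel_def colim_carrier_def by blast

section \<open>Morphisms of pro-objects computed on representatives\<close>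

context
  fixes C :: "('o, 'm, 'z) category_scheme" and V :: "'v itself"
  assumes C: "is_category C"
begin

text \<open>Only transitivity has content: it uses both cofilteredness axioms of the index
  category.\<close>

lemma equiv_colim_rel:
  assumes "X \<in> pro_objects V C"
  shows "equiv (colim_carrier C X W) (colim_rel C X W)"
proof -
  have F: "is_functor C X" and I: "cofiltered V (Shape X)" and S: "is_category (Shape X)"
    using assms by (simp_all add: pro_objects_def cofiltered_def)
  show ?thesis
  proof (rule equivI)
    show "colim_rel C X W \<subseteq> colim_carrier C X W \<times> colim_carrier C X W"
      by (auto simp: colim_rel_def)
    show "refl_on (colim_carrier C X W) (colim_rel C X W)"
    proof (rule refl_onI)
      fix x assume "x \<in> colim_carrier C X W"
      then obtain t g where x: "x = (t, g)" "t \<in> Obj (Shape X)" "g \<in> Hom C (ObM X t) W"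
        unfolding colim_carrier_def by blast
      show "(x, x) \<in> colim_rel C X W"
        unfolding x(1) using x(2,2,2,3,3) ident_in_Hom[OF S x(2)] ident_in_Hom[OF S x(2)] refl
        by (rule colim_relI)
    qed
    show "sym (colim_rel C X W)"
    proof (rule symI)
      fix x y assume *: "(x, y) \<in> colim_rel C X W"
      obtain t g t' g' where xy: "x = (t, g)" "y = (t', g')"
        by (cases x, cases y)
      show "(y, x) \<in> colim_rel C X W"
        using * unfolding xy by (elim colim_relE) (rule colim_relI, auto)
    qed
    show "trans (colim_rel C X W)"
    proof (rule transI)
      fix x y z
      assume xy: "(x, y) \<in> colim_rel C X W" and yz: "(y, z) \<in> colim_rel C X W"
      obtain t g t' g' t'' g'' where xyz: "x = (t, g)" "y = (t', g')" "z = (t'', g'')"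
        by (cases x, cases y, cases z)
      obtain u a b u' a' b'
        where g: "t \<in> Obj (Shape X)" "t' \<in> Obj (Shape X)" "t'' \<in> Obj (Shape X)"
            "g \<in> Hom C (ObM X t) W" "g' \<in> Hom C (ObM X t') W" "g'' \<in> Hom C (ObM X t'') W"
          and u: "u \<in> Obj (Shape X)" "a \<in> Hom (Shape X) u t" "b \<in> Hom (Shape X) u t'"
            "g \<cdot>\<^bsub>C\<^esub> ArM X a = g' \<cdot>\<^bsub>C\<^esub> ArM X b"
          and u': "u' \<in> Obj (Shape X)" "a' \<in> Hom (Shape X) u' t'" "b' \<in> Hom (Shape X) u' t''"
            "g' \<cdot>\<^bsub>C\<^esub> ArM X a' = g'' \<cdot>\<^bsub>C\<^esub> ArM X b'"
        using xy yz unfolding xyz by (elim colim_relE) blast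
      \<comment> \<open>The two relations are witnessed at \<open>u\<close> and \<open>u'\<close>,
        which both map to \<open>t'\<close>. A stage \<open>w\<close> over both gives two arrows
        from \<open>w\<close> to \<open>t'\<close>, possibly different; \<open>h\<close> then
        equalizes them.\<close>
      obtain w c c' where w: "w \<in> Obj (Shape X)" "c \<in> Hom (Shape X) w u" "c' \<in> Hom (Shape X) w u'"
        using I u(1) u'(1) unfolding cofiltered_def by blast
      have "b \<cdot>\<^bsub>Shape X\<^esub> c \<in> Hom (Shape X) w t'" "a' \<cdot>\<^bsub>Shape X\<^esub> c' \<in> Hom (Shape X) w t'"
        using comp_in_Hom[OF S] u u' w by blast+
      then obtain h where h: "h \<in> Arr (Shape X)" "Cod (Shape X) h = w"
        "(b \<cdot>\<^bsub>Shape X\<^esub> c) \<cdot>\<^bsub>Shape X\<^esub> h = (a' \<cdot>\<^bsub>Shape X\<^esub> c') \<cdot>\<^bsub>Shape X\<^esub> h"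
        using I w(1) g(2) unfolding cofiltered_def by blast
      let ?z = "Dom (Shape X) h"
      have hH: "h \<in> Hom (Shape X) ?z w" and z: "?z \<in> Obj (Shape X)"
        using h Dom_in_Obj[OF S] by (auto simp: Hom_def)
      let ?d = "c \<cdot>\<^bsub>Shape X\<^esub> h" and ?d' = "c' \<cdot>\<^bsub>Shape X\<^esub> h"
      have d: "?d \<in> Hom (Shape X) ?z u" "?d' \<in> Hom (Shape X) ?z u'"
        using comp_in_Hom[OF S] w hH by blast+
      have eq: "b \<cdot>\<^bsub>Shape X\<^esub> ?d = a' \<cdot>\<^bsub>Shape X\<^esub> ?d'"
        using h(3) comp_assoc[OF S hH w(2) u(3)] comp_assoc[OF S hH w(3) u'(2)] by simp
      have *: "k \<cdot>\<^bsub>C\<^esub> ArM X (e \<cdot>\<^bsub>Shape X\<^esub> f) = (k \<cdot>\<^bsub>C\<^esub> ArM X e) \<cdot>\<^bsub>C\<^esub> ArM X f"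
        if "f \<in> Hom (Shape X) z1 u1" "e \<in> Hom (Shape X) u1 t1" "k \<in> Hom C (ObM X t1) W" for k e f z1 u1 t1
        using functor_comp[OF F that(1,2)]
          comp_assoc[OF C functor_Hom[OF F that(1)] functor_Hom[OF F that(2)] that(3)] by simp
      have "g \<cdot>\<^bsub>C\<^esub> ArM X (a \<cdot>\<^bsub>Shape X\<^esub> ?d) = g'' \<cdot>\<^bsub>C\<^esub> ArM X (b' \<cdot>\<^bsub>Shape X\<^esub> ?d')"
        using *[OF d(1) u(2) g(4)] *[OF d(1) u(3) g(5)] *[OF d(2) u'(2) g(5)] *[OF d(2) u'(3) g(6)]
          eq u(4) u'(4) by simp
      then show "(x, z) \<in> colim_rel C X W"
        unfolding xyz using g(1,3) z g(4,6) comp_in_Hom[OF S u(2) d(1)] comp_in_Hom[OF S u'(3) d(2)]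
        by (intro colim_relI)
    qed
  qed
qed

text \<open>\<open>colim_post\<close> is a union over all representatives. They all contribute the
  same class and there is at least one, so the union is that class.\<close>

lemma colim_post_class:
  assumes X: "X \<in> pro_objects V C" and k: "k \<in> Hom C W W'"
    and tg: "t \<in> Obj (Shape X)" "g \<in> Hom C (ObM X t) W"
  shows "colim_post C X k (colim_rel C X W `` {(t, g)}) = colim_rel C X W' `` {(t, k \<cdot>\<^bsub>C\<^esub> g)}"
proof -
  have F: "is_functor C X"
    using X by (auto simp: pro_objects_def)
  have cod: "Cod C k = W'"
    using k by (simp add: Hom_def)
  have *: "colim_rel C X W' `` {(t', k \<cdot>\<^bsub>C\<^esub> g')} = colim_rel C X W' `` {(t, k \<cdot>\<^bsub>C\<^esub> g)}"
    if rel: "((t, g), (t', g')) \<in> colim_rel C X W" for t' g'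
  proof -
    obtain u a b where u: "t' \<in> Obj (Shape X)" "g' \<in> Hom C (ObM X t') W" "u \<in> Obj (Shape X)"
      "a \<in> Hom (Shape X) u t" "b \<in> Hom (Shape X) u t'" "g \<cdot>\<^bsub>C\<^esub> ArM X a = g' \<cdot>\<^bsub>C\<^esub> ArM X b"
      using rel by (elim colim_relE)
    have "(k \<cdot>\<^bsub>C\<^esub> g) \<cdot>\<^bsub>C\<^esub> ArM X a = (k \<cdot>\<^bsub>C\<^esub> g') \<cdot>\<^bsub>C\<^esub> ArM X b"
      using comp_assoc[OF C functor_Hom[OF F u(4)] tg(2) k]
        comp_assoc[OF C functor_Hom[OF F u(5)] u(2) k] u(6) by simp
    then have "((t, k \<cdot>\<^bsub>C\<^esub> g), (t', k \<cdot>\<^bsub>C\<^esub> g')) \<in> colim_rel C X W'"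
      using u tg comp_in_Hom[OF C k] by (intro colim_relI)
    then show ?thesis
      by (rule equiv_class_eq[OF equiv_colim_rel[OF X], symmetric])
  qed
  have "(t, g) \<in> colim_carrier C X W"
    using tg by (simp add: colim_carrier_def)
  then have self: "(t, g) \<in> colim_rel C X W `` {(t, g)}"
    by (rule equiv_class_self[OF equiv_colim_rel[OF X]])
  have "(\<Union>(t', g') \<in> colim_rel C X W `` {(t, g)}. colim_rel C X W' `` {(t', k \<cdot>\<^bsub>C\<^esub> g')}) =
      colim_rel C X W' `` {(t, k \<cdot>\<^bsub>C\<^esub> g)}"
  proof (rule SUP_eq_const)
    show "colim_rel C X W `` {(t, g)} \<noteq> {}"
      using self by blast
    fix x assume "x \<in> colim_rel C X W `` {(t, g)}"
    then show "(case x of (t', g') \<Rightarrow> colim_rel C X W' `` {(t', k \<cdot>\<^bsub>C\<^esub> g')}) =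
        colim_rel C X W' `` {(t, k \<cdot>\<^bsub>C\<^esub> g)}"
      using * by (cases x) simp
  qed
  then show ?thesis
    unfolding colim_post_def cod .
qed

lemma pro_Hom_rep:
  assumes X: "X \<in> pro_objects V C" and \<phi>: "\<phi> \<in> pro_Hom C X Y" and s: "s \<in> Obj (Shape Y)"
    and tg: "(t, g) \<in> \<phi> s"
  shows "t \<in> Obj (Shape X)" "g \<in> Hom C (ObM X t) (ObM Y s)"
    "\<phi> s = colim_rel C X (ObM Y s) `` {(t, g)}"
proof -
  have q: "\<phi> s \<in> colim_carrier C X (ObM Y s) // colim_rel C X (ObM Y s)"
    using \<phi> s by (auto simp: pro_Hom_def colim_Hom_def)
  note E = equiv_colim_rel[OF X]
  have c: "(t, g) \<in> colim_carrier C X (ObM Y s)"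
    using q tg in_quotient_imp_subset[OF E] by blast
  then show "t \<in> Obj (Shape X)" "g \<in> Hom C (ObM X t) (ObM Y s)"
    by (auto simp: colim_carrier_def)
  show "\<phi> s = colim_rel C X (ObM Y s) `` {(t, g)}"
    using q tg by (elim quotientE) (simp add: equiv_class_eq[OF E])
qed

lemma pro_Hom_nonempty:
  assumes X: "X \<in> pro_objects V C" and \<phi>: "\<phi> \<in> pro_Hom C X Y" and s: "s \<in> Obj (Shape Y)"
  obtains t g where "(t, g) \<in> \<phi> s"
proof -
  have "\<phi> s \<in> colim_carrier C X (ObM Y s) // colim_rel C X (ObM Y s)"
    using \<phi> s by (auto simp: pro_Hom_def colim_Hom_def)
  then have "\<phi> s \<noteq> {}"
    using in_quotient_imp_non_empty[OF equiv_colim_rel[OF X]] by blast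
  then show thesis
    using that by fast
qed

lemma pro_HomI:
  assumes X: "X \<in> pro_objects V C" and Y: "is_functor C Y"
    and t: "\<And>s. s \<in> Obj (Shape Y) \<Longrightarrow> t s \<in> Obj (Shape X)"
    and g: "\<And>s. s \<in> Obj (Shape Y) \<Longrightarrow> g s \<in> Hom C (ObM X (t s)) (ObM Y s)"
    and compat: "\<And>b s s'. b \<in> Hom (Shape Y) s s' \<Longrightarrow>
      ((t s, ArM Y b \<cdot>\<^bsub>C\<^esub> g s), (t s', g s')) \<in> colim_rel C X (ObM Y s')"
  shows "(\<lambda>s \<in> Obj (Shape Y). colim_rel C X (ObM Y s) `` {(t s, g s)}) \<in> pro_Hom C X Y"
proof -
  have "colim_post C X (ArM Y b) (colim_rel C X (ObM Y s) `` {(t s, g s)}) =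
      colim_rel C X (ObM Y s') `` {(t s', g s')}"
    if b: "b \<in> Hom (Shape Y) s s'" "s \<in> Obj (Shape Y)" for b s s'
    unfolding colim_post_class[OF X functor_Hom[OF Y b(1)] t[OF b(2)] g[OF b(2)]]
    by (rule equiv_class_eq[OF equiv_colim_rel[OF X] compat[OF b(1)]])
  moreover have "b \<in> Hom (Shape Y) (Dom (Shape Y) b) (Cod (Shape Y) b)" if "b \<in> Arr (Shape Y)" for b
    using that by (simp add: Hom_def)
  moreover from this have "Dom (Shape Y) b \<in> Obj (Shape Y)" "Cod (Shape Y) b \<in> Obj (Shape Y)"
    if "b \<in> Arr (Shape Y)" for b
    using Dom_in_Obj[of "Shape Y"] Cod_in_Obj[of "Shape Y"] Y[unfolded is_functor_def] that by metis+
  moreover have "colim_rel C X (ObM Y s) `` {(t s, g s)} \<in> colim_Hom C X (ObM Y s)"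
    if "s \<in> Obj (Shape Y)" for s
    unfolding colim_Hom_def by (rule quotientI) (simp add: colim_carrier_def t g that)
  ultimately show ?thesis
    unfolding pro_Hom_def by (simp add: PiE_iff)
qed

text \<open>Any choice of representatives computes the composite. Two representatives of
  \<open>\<psi> u\<close> agree at some common stage \<open>w\<close> of \<open>Y\<close>, and
  compatibility of \<open>\<phi>\<close> expresses the relevant components of \<open>\<phi>\<close>
  through \<open>\<phi> w\<close>. The objects \<open>Y'\<close> and \<open>Y''\<close> are
  arbitrary since \<open>pro_comp\<close> discards them.\<close>

lemma pro_comp_class:
  assumes X: "X \<in> pro_objects V C" and Y: "Y \<in> pro_objects V C"
    and \<phi>: "\<phi> \<in> pro_Hom C X Y" and \<psi>: "\<psi> \<in> pro_Hom C Y Z"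
    and u: "u \<in> Obj (Shape Z)" and sh: "(s, h) \<in> \<psi> u" and tg: "(t, g) \<in> \<phi> s"
  shows "snd (snd (pro_comp C (Y', Z, \<psi>) (X, Y'', \<phi>))) u = colim_rel C X (ObM Z u) `` {(t, h \<cdot>\<^bsub>C\<^esub> g)}"
proof -
  note FY = Y[unfolded pro_objects_def, THEN CollectD, THEN conjunct2]
  note sh' = pro_Hom_rep[OF Y \<psi> u sh]
  note tg' = pro_Hom_rep[OF X \<phi> sh'(1) tg]
  have post: "colim_post C X h (\<phi> s) = colim_rel C X (ObM Z u) `` {(t, h \<cdot>\<^bsub>C\<^esub> g)}"
    using colim_post_class[OF X sh'(2) tg'(1,2)] tg'(3) by simp
  have "colim_post C X h1 (\<phi> s1) = colim_post C X h (\<phi> s)" if sh1: "(s1, h1) \<in> \<psi> u" for s1 h1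
  proof -
    note sh1' = pro_Hom_rep[OF Y \<psi> u sh1]
    obtain w a b where w: "w \<in> Obj (Shape Y)" "a \<in> Hom (Shape Y) w s" "b \<in> Hom (Shape Y) w s1"
      "h \<cdot>\<^bsub>C\<^esub> ArM Y a = h1 \<cdot>\<^bsub>C\<^esub> ArM Y b"
      using sh1 unfolding sh'(3) Image_singleton_iff by (elim colim_relE)
    obtain t0 g0 where tg0: "(t0, g0) \<in> \<phi> w"
      using pro_Hom_nonempty[OF X \<phi> w(1)] .
    note rep0 = pro_Hom_rep[OF X \<phi> w(1) tg0]
    \<comment> \<open>Evaluating from the representative \<open>(t0, g0)\<close> of
      \<open>\<phi> w\<close> makes both sides depend only on \<open>k\<close> composed with
      \<open>ArM Y c\<close>, and these composites agree for the two representatives.\<close>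
    have *: "colim_post C X k (\<phi> s2) = colim_rel C X (ObM Z u) `` {(t0, (k \<cdot>\<^bsub>C\<^esub> ArM Y c) \<cdot>\<^bsub>C\<^esub> g0)}"
      if c: "c \<in> Hom (Shape Y) w s2" and k: "k \<in> Hom C (ObM Y s2) (ObM Z u)" for k c s2
    proof -
      have "\<phi> s2 = colim_post C X (ArM Y c) (\<phi> w)"
        using \<phi> c by (auto simp: pro_Hom_def Hom_def)
      also have "\<dots> = colim_rel C X (ObM Y s2) `` {(t0, ArM Y c \<cdot>\<^bsub>C\<^esub> g0)}"
        unfolding rep0(3) by (rule colim_post_class[OF X functor_Hom[OF FY c] rep0(1,2)])
      finally have "colim_post C X k (\<phi> s2) = colim_rel C X (ObM Z u) `` {(t0, k \<cdot>\<^bsub>C\<^esub> (ArM Y c \<cdot>\<^bsub>C\<^esub> g0))}"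
        using colim_post_class[OF X k rep0(1) comp_in_Hom[OF C functor_Hom[OF FY c] rep0(2)]] by simp
      then show ?thesis
        using comp_assoc[OF C rep0(2) functor_Hom[OF FY c] k] by simp
    qed
    show ?thesis
      using *[OF w(2) sh'(2)] *[OF w(3) sh1'(2)] w(4) by simp
  qed
  then have "(\<Union>(s1, h1) \<in> \<psi> u. colim_post C X h1 (\<phi> s1)) = colim_post C X h (\<phi> s)"
    using sh by fast
  then show ?thesis
    using u post by (simp add: pro_comp_def)
qed

lemma pro_of_nat_in_Hom:
  assumes X: "X \<in> pro_objects V C" and Y: "Y \<in> pro_objects V C"
    and \<tau>: "natural_transformation C X Y \<tau>"
  shows "snd (snd (pro_of_nat C X Y \<tau>)) \<in> pro_Hom C X Y"
proof -
  have FX: "is_functor C X" and FY: "is_functor C Y" and S: "Shape X = Shape Y"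
    and T: "\<And>s. s \<in> Obj (Shape Y) \<Longrightarrow> \<tau> s \<in> Hom C (ObM X s) (ObM Y s)"
    and IY: "is_category (Shape Y)"
    using X Y \<tau> by (simp_all add: pro_objects_def natural_transformation_def cofiltered_def)
  \<comment> \<open>The two representatives become equal at stage \<open>s\<close>, along the
    identity and along \<open>b\<close>; this is the naturality square.\<close>
  have "((s, ArM Y b \<cdot>\<^bsub>C\<^esub> \<tau> s), (s', \<tau> s')) \<in> colim_rel C X (ObM Y s')"
    if b: "b \<in> Hom (Shape Y) s s'" for b s s'
  proof -
    have s: "s \<in> Obj (Shape Y)" "s' \<in> Obj (Shape Y)"
      using Dom_in_Obj[OF IY b] Cod_in_Obj[OF IY b] by auto
    have Ys: "ArM Y b \<cdot>\<^bsub>C\<^esub> \<tau> s \<in> Hom C (ObM X s) (ObM Y s')"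
      using comp_in_Hom[OF C functor_Hom[OF FY b] T[OF s(1)]] .
    have nat: "ArM Y b \<cdot>\<^bsub>C\<^esub> \<tau> s = \<tau> s' \<cdot>\<^bsub>C\<^esub> ArM X b"
      using \<tau> b S by (auto simp: natural_transformation_def Hom_def)
    have "(ArM Y b \<cdot>\<^bsub>C\<^esub> \<tau> s) \<cdot>\<^bsub>C\<^esub> ArM X (Ident (Shape Y) s) = \<tau> s' \<cdot>\<^bsub>C\<^esub> ArM X b"
      using comp_ident[OF C Ys] functor_ident[OF FX] s(1) S nat by simp
    then show ?thesis
      using S s b T[OF s(2)] Ys ident_in_Hom[OF IY s(1)] by (intro colim_relI) simp_all
  qed
  then show ?thesis
    unfolding pro_of_nat_def snd_conv using S T by (intro pro_HomI[OF X FY]) auto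
qed

end

context
  fixes C :: "('o, 'm, 'z) category_scheme" and V :: "'v itself"
  assumes C: "is_category C"
begin

text \<open>For an equation between arrows, one convenient pair of representatives per component
  suffices.\<close>

lemma pro_comp_eqI:
  assumes X: "X \<in> pro_objects V C" and Y: "Y \<in> pro_objects V C"
    and \<phi>: "\<phi> \<in> pro_Hom C X Y" and \<psi>: "\<psi> \<in> pro_Hom C Y Z" and \<xi>: "\<xi> \<in> pro_Hom C X Z"
    and rep: "\<And>u. u \<in> Obj (Shape Z) \<Longrightarrow>
      \<exists>s h t g. (s, h) \<in> \<psi> u \<and> (t, g) \<in> \<phi> s \<and> \<xi> u = colim_rel C X (ObM Z u) `` {(t, h \<cdot>\<^bsub>C\<^esub> g)}"
  shows "pro_comp C (Y', Z, \<psi>) (X, Y'', \<phi>) = (X, Z, \<xi>)"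
proof -
  have "snd (snd (pro_comp C (Y', Z, \<psi>) (X, Y'', \<phi>))) = \<xi>"
  proof (rule extensionalityI[of _ "Obj (Shape Z)"])
    show "\<xi> \<in> extensional (Obj (Shape Z))"
      using \<xi> by (simp add: pro_Hom_def PiE_def)
    show "snd (snd (pro_comp C (Y', Z, \<psi>) (X, Y'', \<phi>))) \<in> extensional (Obj (Shape Z))"
      by (simp add: pro_comp_def)
    fix u assume u: "u \<in> Obj (Shape Z)"
    show "snd (snd (pro_comp C (Y', Z, \<psi>) (X, Y'', \<phi>))) u = \<xi> u"
      using rep[OF u] pro_comp_class[OF C X Y \<phi> \<psi> u] by metis
  qed
  then show ?thesis
    by (simp add: pro_comp_def)
qed

end

lemma pro_Arr_iff:
  "(X, Y, \<phi>) \<in> Arr (pro_category V C) \<longleftrightarrow>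
     X \<in> pro_objects V C \<and> Y \<in> pro_objects V C \<and> \<phi> \<in> pro_Hom C X Y"
  by (simp add: pro_category_def)

lemma in_pro_HomE:
  assumes "f \<in> Hom (pro_category V C) X Y"
  obtains \<phi> where "f = (X, Y, \<phi>)" "X \<in> pro_objects V C" "Y \<in> pro_objects V C" "\<phi> \<in> pro_Hom C X Y"
  using assms by (cases f) (auto simp: Hom_def pro_category_def)

section \<open>Constant pro-objects and preorders\<close>

lemma Hom_poset_category: "Hom (poset_category r) t s = (if (s, t) \<in> r then {(t, s)} else {})"
  by (auto simp: Hom_def poset_category_def)

lemma Obj_poset_category [simp]: "Obj (poset_category r) = Field r"
  by (simp add: poset_category_def)

text \<open>Preorders are the right generality here: the index order of the quotients is not
  antisymmetric, as distinct idempotents with the same kernel lie below each other.\<close>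

lemma is_category_poset_category:
  assumes "refl_on (Field r) r" "trans r"
  shows "is_category (poset_category r)"
  unfolding is_category_def poset_category_def
  using assms by (auto simp: Hom_def Field_def dest: refl_onD transD)

lemma cofiltered_poset_category:
  assumes "refl_on (Field r) r" "trans r" "r \<noteq> {}" "small V r"
    and "\<And>s t. s \<in> Field r \<Longrightarrow> t \<in> Field r \<Longrightarrow> \<exists>u. (s, u) \<in> r \<and> (t, u) \<in> r"
  shows "cofiltered V (poset_category r)"
proof -
  have "Field r = fst ` r" "{(t, s). (s, t) \<in> r} = prod.swap ` r"
    using assms(1) by (force simp: Field_def dest: refl_onD)+
  then have "small V (Field r)" "small V (Arr (poset_category r))"
    using assms(4) by (simp_all add: small_image poset_category_def)
  moreover have "Field r \<noteq> {}"
    using assms(3) by (simp add: Field_def Domain_empty_iff)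
  moreover have "\<exists>u \<in> Field r. Hom (poset_category r) u s \<noteq> {} \<and> Hom (poset_category r) u t \<noteq> {}"
    if "s \<in> Field r" "t \<in> Field r" for s t
  proof -
    obtain u where "(s, u) \<in> r" "(t, u) \<in> r"
      using assms(5) \<open>s \<in> Field r\<close> \<open>t \<in> Field r\<close> by blast
    then show ?thesis
      by (intro bexI[of _ u]) (auto simp: Hom_poset_category Field_def)
  qed
  moreover have "\<exists>h \<in> Arr (poset_category r). Cod (poset_category r) h = s \<and>
      f \<cdot>\<^bsub>poset_category r\<^esub> h = g \<cdot>\<^bsub>poset_category r\<^esub> h"
    if "s \<in> Field r" "f \<in> Hom (poset_category r) s t" "g \<in> Hom (poset_category r) s t" for s t f g
  proof (intro bexI conjI)
    have "f = g"
      using that(2,3) by (auto simp: Hom_poset_category split: if_splits)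
    then show "f \<cdot>\<^bsub>poset_category r\<^esub> (s, s) = g \<cdot>\<^bsub>poset_category r\<^esub> (s, s)"
      by simp
    show "Cod (poset_category r) (s, s) = s" "(s, s) \<in> Arr (poset_category r)"
      using refl_onD[OF assms(1) that(1)] by (simp_all add: poset_category_def)
  qed
  ultimately show ?thesis
    unfolding cofiltered_def Obj_poset_category using is_category_poset_category[OF assms(1,2)]
    by (intro conjI ballI)
qed

definition constant_pro :: "('o, 'm, 'z) category_scheme \<Rightarrow> 'v \<Rightarrow> 'o \<Rightarrow> ('v, 'o, 'm) pro_object" where
  "constant_pro C w A =
     \<lparr>Shape = poset_category {(w, w)}, ObM = (\<lambda>_. A), ArM = (\<lambda>_. Ident C A)\<rparr>"

lemma constant_pro_simps [simp]:
  "Shape (constant_pro C w A) = poset_category {(w, w)}"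
  "ObM (constant_pro C w A) = (\<lambda>_. A)"
  "ArM (constant_pro C w A) = (\<lambda>_. Ident C A)"
  by (simp_all add: constant_pro_def)

context
  fixes C :: "('o, 'm, 'z) category_scheme" and V :: "'v itself"
  assumes C: "is_category C"
begin

lemma constant_pro_in_pro_objects:
  assumes "inaccessible_universe V" "A \<in> Obj C"
  shows "constant_pro C w A \<in> pro_objects V C"
proof -
  have "small V {(w, w)}"
    using infinite_universe[OF assms(1)] unfolding small_def by (intro finite_ordLess_infinite2) simp_all
  then have "cofiltered V (poset_category {(w, w)})"
    by (intro cofiltered_poset_category) (auto simp: refl_on_def trans_def)
  then show ?thesis
    using assms(2) ident_in_Hom[OF C] comp_ident[OF C ident_in_Hom[OF C]]
    by (simp add: pro_objects_def is_functor_def cofiltered_def)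
qed

text \<open>The only transition map is an identity, so nothing is identified. Components of maps out
  of a constant pro-object are thereby single morphisms of \<open>C\<close>, and equality of classes
  is equality of morphisms.\<close>

lemma colim_rel_constant_pro:
  assumes "g \<in> Hom C A W"
  shows "colim_rel C (constant_pro C w A) W `` {(w, g)} = {(w, g)}"
proof -
  have "y = (w, g)" if "((w, g), y) \<in> colim_rel C (constant_pro C w A) W" for y
  proof -
    obtain t' g' where y: "y = (t', g')"
      by (cases y)
    show ?thesis
      using that unfolding y
      by (elim colim_relE) (simp add: comp_ident[OF C])
  qed
  moreover have "((w, g), (w, g)) \<in> colim_rel C (constant_pro C w A) W"
    using assms
    by (intro colim_relI[where u = w and a = "(w, w)" and b = "(w, w)"])
      (simp_all add: Hom_poset_category)
  ultimately show ?thesis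
    by blast
qed

end

section \<open>The pro-object of a system of split idempotents\<close>

text \<open>The assumption \<open>split\<close> makes \<open>i t\<close> a section of
  \<open>q t\<close>, so that \<open>i t\<close> after \<open>q t\<close> is an idempotent of
  \<open>A\<close>. The assumption \<open>refine\<close> says that \<open>q s\<close> factors
  through \<open>q t\<close> for \<open>t\<close> above \<open>s\<close>, the factor being
  \<open>q s\<close> after \<open>i t\<close>.\<close>

locale split_idempotents =
  fixes V :: "'v itself" and C :: "('o, 'm, 'z) category_scheme" and A :: 'o
    and r :: "'v rel" and Q :: "'v \<Rightarrow> 'o" and q i :: "'v \<Rightarrow> 'm"
  assumes universe: "inaccessible_universe V"
    and C: "is_category C" and A: "A \<in> Obj C"
    and refl_r: "refl_on (Field r) r" and trans_r: "trans r" and small_r: "small V r"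
    and nonempty_r: "r \<noteq> {}"
    and directed_r: "\<And>s t. s \<in> Field r \<Longrightarrow> t \<in> Field r \<Longrightarrow> \<exists>u. (s, u) \<in> r \<and> (t, u) \<in> r"
    and q: "\<And>t. t \<in> Field r \<Longrightarrow> q t \<in> Hom C A (Q t)"
    and i: "\<And>t. t \<in> Field r \<Longrightarrow> i t \<in> Hom C (Q t) A"
    and split: "\<And>t. t \<in> Field r \<Longrightarrow> q t \<cdot>\<^bsub>C\<^esub> i t = Ident C (Q t)"
    and refine: "\<And>s t. (s, t) \<in> r \<Longrightarrow> q s \<cdot>\<^bsub>C\<^esub> (i t \<cdot>\<^bsub>C\<^esub> q t) = q s"
begin

text \<open>The transition map from \<open>Q t\<close> to \<open>Q s\<close> is the factor of
  \<open>q s\<close> through \<open>q t\<close>.\<close>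

definition quotients :: "('v, 'o, 'm) pro_object" where
  "quotients = \<lparr>Shape = poset_category r, ObM = Q, ArM = (\<lambda>(t, s). q s \<cdot>\<^bsub>C\<^esub> i t)\<rparr>"

lemma quotients_simps [simp]:
  "Shape quotients = poset_category r" "ObM quotients = Q"
  "ArM quotients (t, s) = q s \<cdot>\<^bsub>C\<^esub> i t"
  by (simp_all add: quotients_def)

text \<open>This is the map \<open>f\<close> of the overview. Its classes can be written as
  singletons by \<open>colim_rel_constant_pro\<close>.\<close>

definition projection :: "'v \<Rightarrow> ('v, 'o, 'm) pro_arrow" where
  "projection w = (constant_pro C w A, quotients, \<lambda>t \<in> Field r. {(w, q t)})"

lemma Q: "t \<in> Field r \<Longrightarrow> Q t \<in> Obj C"
  using Cod_in_Obj[OF C q] .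

lemma comp_refine:
  assumes "(s, t) \<in> r" "g \<in> Hom C (Q s) x"
  shows "(g \<cdot>\<^bsub>C\<^esub> q s) \<cdot>\<^bsub>C\<^esub> (i t \<cdot>\<^bsub>C\<^esub> q t) = g \<cdot>\<^bsub>C\<^esub> q s"
proof -
  have "s \<in> Field r" "t \<in> Field r"
    using assms(1) by (auto simp: Field_def)
  then show ?thesis
    using comp_assoc[OF C comp_in_Hom[OF C i q] q assms(2)] refine[OF assms(1)] by simp
qed

lemma quotients_in_pro_objects: "quotients \<in> pro_objects V C"
proof -
  have cof: "cofiltered V (poset_category r)"
    using refl_r trans_r nonempty_r small_r directed_r by (rule cofiltered_poset_category)
  have F: "s \<in> Field r" "t \<in> Field r" if "(s, t) \<in> r" for s t
    using that by (auto simp: Field_def)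
  \<comment> \<open>Functoriality: the idempotent of the intermediate index \<open>s\<close> may be
    inserted after \<open>q u\<close>, which absorbs it by \<open>refine\<close>.\<close>
  have comp: "q u \<cdot>\<^bsub>C\<^esub> i t = (q u \<cdot>\<^bsub>C\<^esub> i s) \<cdot>\<^bsub>C\<^esub> (q s \<cdot>\<^bsub>C\<^esub> i t)" if "(u, s) \<in> r" "(s, t) \<in> r" for u s t
  proof -
    note [simp] = F[OF that(1)] F[OF that(2)]
    have "q u \<cdot>\<^bsub>C\<^esub> i t = (q u \<cdot>\<^bsub>C\<^esub> (i s \<cdot>\<^bsub>C\<^esub> q s)) \<cdot>\<^bsub>C\<^esub> i t"
      by (simp add: refine[OF that(1)])
    also have "\<dots> = ((q u \<cdot>\<^bsub>C\<^esub> i s) \<cdot>\<^bsub>C\<^esub> q s) \<cdot>\<^bsub>C\<^esub> i t"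
      using comp_assoc[OF C q[of s] i[of s] q[of u]] by simp
    also have "\<dots> = (q u \<cdot>\<^bsub>C\<^esub> i s) \<cdot>\<^bsub>C\<^esub> (q s \<cdot>\<^bsub>C\<^esub> i t)"
      using comp_assoc[OF C i[of t] q[of s] comp_in_Hom[OF C q[of u] i[of s]]] by simp
    finally show ?thesis .
  qed
  have "is_functor C quotients"
    unfolding is_functor_def
  proof (intro conjI ballI impI)
    show "is_category (Shape quotients)"
      using is_category_poset_category[OF refl_r trans_r] by simp
    fix s assume s: "s \<in> Obj (Shape quotients)"
    show "ObM quotients s \<in> Obj C"
      using Q s by simp
    show "ArM quotients (Ident (Shape quotients) s) = Ident C (ObM quotients s)"
      using split s by (simp add: poset_category_def)
  next
    fix a assume "a \<in> Arr (Shape quotients)"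
    then obtain s t where a: "a = (t, s)" "(s, t) \<in> r"
      by (auto simp: poset_category_def)
    show "ArM quotients a \<in> Hom C (ObM quotients (Dom (Shape quotients) a)) (ObM quotients (Cod (Shape quotients) a))"
      using comp_in_Hom[OF C q[OF F(1)[OF a(2)]] i[OF F(2)[OF a(2)]]] a(1) by (simp add: poset_category_def)
  next
    fix a b assume "a \<in> Arr (Shape quotients)" "b \<in> Arr (Shape quotients)"
      "Dom (Shape quotients) b = Cod (Shape quotients) a"
    then obtain t s u where "a = (t, s)" "(s, t) \<in> r" "b = (s, u)" "(u, s) \<in> r"
      by (auto simp: poset_category_def)
    then show "ArM quotients (b \<cdot>\<^bsub>Shape quotients\<^esub> a) = ArM quotients b \<cdot>\<^bsub>C\<^esub> ArM quotients a"
      using comp by (simp add: poset_category_def)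
  qed
  then show ?thesis
    using cof by (simp add: pro_objects_def)
qed

lemma const_A: "constant_pro C w A \<in> pro_objects V C"
  using constant_pro_in_pro_objects[OF C universe A] .

lemma projection_in_pro_Hom:
  "(\<lambda>t \<in> Field r. {(w, q t)}) \<in> pro_Hom C (constant_pro C w A) quotients"
proof -
  have "(\<lambda>t \<in> Obj (Shape quotients). colim_rel C (constant_pro C w A) (ObM quotients t) `` {(w, q t)})
      \<in> pro_Hom C (constant_pro C w A) quotients"
  proof (rule pro_HomI[OF C const_A])
    show "is_functor C quotients"
      using quotients_in_pro_objects by (simp add: pro_objects_def)
  next
    fix b t s assume "b \<in> Hom (Shape quotients) t s"
    then have b: "b = (t, s)" "(s, t) \<in> r" "s \<in> Field r" "t \<in> Field r"
      by (auto simp: Hom_poset_category Field_def split: if_splits)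
    have "ArM quotients b \<cdot>\<^bsub>C\<^esub> q t = q s"
      using comp_assoc[OF C q[OF b(4)] i[OF b(4)] q[OF b(3)]] refine[OF b(2)] b(1) by simp
    then show "((w, ArM quotients b \<cdot>\<^bsub>C\<^esub> q t), w, q s) \<in> colim_rel C (constant_pro C w A) (ObM quotients s)"
      using colim_rel_constant_pro[OF C q[OF b(3)], of w] by (simp flip: Image_singleton_iff)
  qed (use q in simp_all)
  moreover have "(\<lambda>t \<in> Obj (Shape quotients). colim_rel C (constant_pro C w A) (ObM quotients t) `` {(w, q t)}) =
      (\<lambda>t \<in> Field r. {(w, q t)})"
    unfolding quotients_simps Obj_poset_category
    by (rule restrict_ext) (rule colim_rel_constant_pro[OF C q])
  ultimately show ?thesis
    by simp
qed

lemma projection_in_Arr: "projection w \<in> Arr (pro_category V C)"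
  unfolding projection_def pro_Arr_iff
  using const_A quotients_in_pro_objects projection_in_pro_Hom by blast

text \<open>The hypothesis \<open>factor\<close> supplies one index \<open>t\<close> for all
  components of a map from the constant pro-object. If these components are \<open>m s\<close>, then
  \<open>m s\<close> after \<open>i t\<close> defines the lift. The upper triangle is the
  factorization. For the lower one, the two maps out of \<open>quotients\<close> agree after
  composition with the projection, and the projection can be cancelled.\<close>

lemma projection_has_left_lifting:
  assumes p: "p \<in> Arr (pro_category V C)"
    and factor: "\<And>\<phi>. \<phi> \<in> pro_Hom C (constant_pro C w A) (Dom (pro_category V C) p) \<Longrightarrow>
      \<exists>t \<in> Field r. \<forall>s \<in> Obj (Shape (Dom (pro_category V C) p)). \<forall>m. (w, m) \<in> \<phi> s \<longrightarrow> m \<cdot>\<^bsub>C\<^esub> (i t \<cdot>\<^bsub>C\<^esub> q t) = m"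
  shows "has_left_lifting (pro_category V C) (projection w) p"
proof -
  obtain E B \<psi> where p_eq: "p = (E, B, \<psi>)"
    by (cases p)
  have E: "E \<in> pro_objects V C" and B: "B \<in> pro_objects V C" and \<psi>: "\<psi> \<in> pro_Hom C E B"
    using p unfolding p_eq pro_Arr_iff by auto
  have FE: "is_functor C E"
    using E by (simp add: pro_objects_def)
  have P: "Comp (pro_category V C) = pro_comp C" "Dom (pro_category V C) (X, Y, \<phi>) = X"
    "Cod (pro_category V C) (X, Y, \<phi>) = Y" for X Y \<phi>
    by (simp_all add: pro_category_def)
  let ?X = "constant_pro C w A" and ?Y = quotients
  note Y = quotients_in_pro_objects
  show ?thesis
    unfolding has_left_lifting_def p_eq projection_def P
  proof (intro allI impI)
    fix u v
    assume "u \<in> Hom (pro_category V C) ?X E" "v \<in> Hom (pro_category V C) ?Y B"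
      and eq: "pro_comp C (E, B, \<psi>) u = pro_comp C v (?X, ?Y, \<lambda>t \<in> Field r. {(w, q t)})"
    then obtain \<phi> \<xi> where u: "u = (?X, E, \<phi>)" and v: "v = (?Y, B, \<xi>)"
      and \<phi>: "\<phi> \<in> pro_Hom C ?X E" and \<xi>: "\<xi> \<in> pro_Hom C ?Y B"
      by (elim in_pro_HomE) blast
    have "\<exists>m. m \<in> Hom C A (ObM E s) \<and> \<phi> s = {(w, m)}" if s: "s \<in> Obj (Shape E)" for s
    proof -
      obtain t g where tg: "(t, g) \<in> \<phi> s"
        using pro_Hom_nonempty[OF C const_A \<phi> s] .
      note rep = pro_Hom_rep[OF C const_A \<phi> s tg]
      have "t = w" and g: "g \<in> Hom C A (ObM E s)"
        using rep(1,2) by simp_all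
      then have "\<phi> s = {(w, g)}"
        using rep(3) colim_rel_constant_pro[OF C g] by simp
      with g show ?thesis
        by blast
    qed
    then obtain m where m: "\<And>s. s \<in> Obj (Shape E) \<Longrightarrow> m s \<in> Hom C A (ObM E s)"
      and \<phi>_eq: "\<And>s. s \<in> Obj (Shape E) \<Longrightarrow> \<phi> s = {(w, m s)}"
      by metis
    obtain t where t: "t \<in> Field r"
      and fac: "\<And>s. s \<in> Obj (Shape E) \<Longrightarrow> m s \<cdot>\<^bsub>C\<^esub> (i t \<cdot>\<^bsub>C\<^esub> q t) = m s"
      using factor[of \<phi>] \<phi> \<phi>_eq unfolding p_eq P by auto
    \<comment> \<open>All representatives live at the same stage \<open>t\<close>, so compatibility
      with the transition maps of \<open>E\<close> holds as an equation in \<open>C\<close>,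
      inherited from \<open>m\<close>.\<close>
    define \<theta> where "\<theta> = (\<lambda>s \<in> Obj (Shape E). colim_rel C ?Y (ObM E s) `` {(t, m s \<cdot>\<^bsub>C\<^esub> i t)})"
    have mi: "m s \<cdot>\<^bsub>C\<^esub> i t \<in> Hom C (Q t) (ObM E s)" if "s \<in> Obj (Shape E)" for s
      using comp_in_Hom[OF C m[OF that] i[OF t]] .
    have self: "(t', g) \<in> colim_rel C ?Y W `` {(t', g)}" if "t' \<in> Field r" "g \<in> Hom C (Q t') W" for t' g W
      using equiv_class_self[OF equiv_colim_rel[OF C Y]] that by (auto simp: colim_carrier_def)
    have \<theta>: "\<theta> \<in> pro_Hom C ?Y E"
      unfolding \<theta>_def
    proof (rule pro_HomI[OF C Y FE])
      fix b s s' assume b: "b \<in> Hom (Shape E) s s'"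
      have s: "s \<in> Obj (Shape E)" "s' \<in> Obj (Shape E)"
        using FE b Dom_in_Obj Cod_in_Obj unfolding is_functor_def by metis+
      note Eb = functor_Hom[OF FE b]
      have "colim_post C ?X (ArM E b) (\<phi> s) = \<phi> s'"
        using \<phi> b by (auto simp: pro_Hom_def Hom_def)
      moreover have "colim_post C ?X (ArM E b) (\<phi> s) = {(w, ArM E b \<cdot>\<^bsub>C\<^esub> m s)}"
        using colim_post_class[OF C const_A Eb, of w w "m s"] m[OF s(1)] comp_in_Hom[OF C Eb m[OF s(1)]]
        by (simp add: \<phi>_eq s colim_rel_constant_pro[OF C])
      ultimately have "ArM E b \<cdot>\<^bsub>C\<^esub> m s = m s'"
        by (simp add: \<phi>_eq s)
      then have "ArM E b \<cdot>\<^bsub>C\<^esub> (m s \<cdot>\<^bsub>C\<^esub> i t) = m s' \<cdot>\<^bsub>C\<^esub> i t"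
        using comp_assoc[OF C i[OF t] m[OF s(1)] Eb] by simp
      then show "((t, ArM E b \<cdot>\<^bsub>C\<^esub> (m s \<cdot>\<^bsub>C\<^esub> i t)), t, m s' \<cdot>\<^bsub>C\<^esub> i t) \<in> colim_rel C ?Y (ObM E s')"
        using self[OF t mi[OF s(2)]] by simp
    qed (use t mi in simp_all)
    have \<theta>_rep: "(t, m s \<cdot>\<^bsub>C\<^esub> i t) \<in> \<theta> s" if "s \<in> Obj (Shape E)" for s
      using self[OF t mi[OF that]] that by (simp add: \<theta>_def)
    show "\<exists>h. h \<in> Hom (pro_category V C) ?Y E \<and>
        pro_comp C h (?X, ?Y, \<lambda>t \<in> Field r. {(w, q t)}) = u \<and> pro_comp C (E, B, \<psi>) h = v"
    proof (intro exI[of _ "(?Y, E, \<theta>)"] conjI)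
      show "(?Y, E, \<theta>) \<in> Hom (pro_category V C) ?Y E"
        using \<theta> Y E by (simp add: Hom_def pro_category_def)
      show "pro_comp C (?Y, E, \<theta>) (?X, ?Y, \<lambda>t \<in> Field r. {(w, q t)}) = u"
        unfolding u
      proof (rule pro_comp_eqI[OF C const_A Y projection_in_pro_Hom \<theta> \<phi>])
        fix s assume s: "s \<in> Obj (Shape E)"
        have "m s \<cdot>\<^bsub>C\<^esub> i t \<cdot>\<^bsub>C\<^esub> q t = m s"
          using comp_assoc[OF C q[OF t] i[OF t] m[OF s]] fac[OF s] by simp
        then have "\<phi> s = colim_rel C ?X (ObM E s) `` {(w, m s \<cdot>\<^bsub>C\<^esub> i t \<cdot>\<^bsub>C\<^esub> q t)}"
          by (simp add: colim_rel_constant_pro[OF C m[OF s]] \<phi>_eq[OF s])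
        moreover have "(w, q t) \<in> (\<lambda>t \<in> Field r. {(w, q t)}) t"
          using t by simp
        ultimately show "\<exists>s' h t' g. (s', h) \<in> \<theta> s \<and> (t', g) \<in> (\<lambda>t \<in> Field r. {(w, q t)}) s' \<and>
            \<phi> s = colim_rel C ?X (ObM E s) `` {(t', h \<cdot>\<^bsub>C\<^esub> g)}"
          using \<theta>_rep[OF s] by blast
      qed
      show "pro_comp C (E, B, \<psi>) (?Y, E, \<theta>) = v"
        unfolding v
      proof (rule pro_comp_eqI[OF C Y E \<theta> \<psi> \<xi>])
        fix j assume j: "j \<in> Obj (Shape B)"
        obtain s k where sk: "(s, k) \<in> \<psi> j"
          using pro_Hom_nonempty[OF C E \<psi> j] .
        note s = pro_Hom_rep(1)[OF C E \<psi> j sk] and k = pro_Hom_rep(2)[OF C E \<psi> j sk]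
        obtain t1 g where tg: "(t1, g) \<in> \<xi> j"
          using pro_Hom_nonempty[OF C Y \<xi> j] .
        have t1: "t1 \<in> Field r" and g: "g \<in> Hom C (Q t1) (ObM B j)"
          and \<xi>_eq: "\<xi> j = colim_rel C ?Y (ObM B j) `` {(t1, g)}"
          using pro_Hom_rep[OF C Y \<xi> j tg] by simp_all
        have ms: "(w, m s) \<in> \<phi> s" and wq: "(w, q t1) \<in> (\<lambda>t \<in> Field r. {(w, q t)}) t1"
          using \<phi>_eq[OF s] t1 by simp_all
        note km = comp_in_Hom[OF C k m[OF s]] and gq = comp_in_Hom[OF C g q[OF t1]]
        \<comment> \<open>The component at \<open>j\<close> of the commuting square of the lifting
          problem, computed from representatives on both sides.\<close>
        have "colim_rel C ?X (ObM B j) `` {(w, k \<cdot>\<^bsub>C\<^esub> m s)} = colim_rel C ?X (ObM B j) `` {(w, g \<cdot>\<^bsub>C\<^esub> q t1)}"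
          using pro_comp_class[OF C const_A E \<phi> \<psi> j sk ms, of E E]
            pro_comp_class[OF C const_A Y projection_in_pro_Hom \<xi> j tg wq, of ?Y ?Y]
            eq unfolding u v by simp
        then have kg: "k \<cdot>\<^bsub>C\<^esub> m s = g \<cdot>\<^bsub>C\<^esub> q t1"
          by (simp add: colim_rel_constant_pro[OF C] km gq)
        \<comment> \<open>Cancelling the projection: composing \<open>kg\<close> with
          \<open>i t2\<close>, for \<open>t2\<close> above both \<open>t\<close> and
          \<open>t1\<close>, yields equality of the two representatives at stage
          \<open>t2\<close>.\<close>
        obtain t2 where t2: "(t, t2) \<in> r" "(t1, t2) \<in> r"
          using directed_r[OF t t1] by blast
        then have t2': "t2 \<in> Field r"
          by (auto simp: Field_def)
        have "(k \<cdot>\<^bsub>C\<^esub> (m s \<cdot>\<^bsub>C\<^esub> i t)) \<cdot>\<^bsub>C\<^esub> (q t \<cdot>\<^bsub>C\<^esub> i t2) = (k \<cdot>\<^bsub>C\<^esub> (m s \<cdot>\<^bsub>C\<^esub> (i t \<cdot>\<^bsub>C\<^esub> q t))) \<cdot>\<^bsub>C\<^esub> i t2"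
          using comp_assoc[OF C i[OF t2'] q[OF t] comp_in_Hom[OF C k mi[OF s]]]
            comp_assoc[OF C q[OF t] mi[OF s] k] comp_assoc[OF C q[OF t] i[OF t] m[OF s]] by simp
        also have "\<dots> = g \<cdot>\<^bsub>C\<^esub> (q t1 \<cdot>\<^bsub>C\<^esub> i t2)"
          using comp_assoc[OF C i[OF t2'] q[OF t1] g] kg fac[OF s] by simp
        finally have "((t1, g), (t, k \<cdot>\<^bsub>C\<^esub> (m s \<cdot>\<^bsub>C\<^esub> i t))) \<in> colim_rel C ?Y (ObM B j)"
          using t t1 t2 t2' g comp_in_Hom[OF C k mi[OF s]]
          by (intro colim_relI[where u = t2 and a = "(t2, t1)" and b = "(t2, t)"])
            (simp_all add: Hom_poset_category)
        then have "\<xi> j = colim_rel C ?Y (ObM B j) `` {(t, k \<cdot>\<^bsub>C\<^esub> (m s \<cdot>\<^bsub>C\<^esub> i t))}"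
          unfolding \<xi>_eq by (rule equiv_class_eq[OF equiv_colim_rel[OF C Y]])
        then show "\<exists>s h t g. (s, h) \<in> \<psi> j \<and> (t, g) \<in> \<theta> s \<and>
            \<xi> j = colim_rel C ?Y (ObM B j) `` {(t, h \<cdot>\<^bsub>C\<^esub> g)}"
          using sk \<theta>_rep[OF s] by blast
      qed
    qed
  qed
qed

text \<open>The level representation lives on other pro-objects, so its monomorphisms have to be
  related to \<open>q t\<close>. At a suitable level \<open>s\<close>, the component
  \<open>e\<close> from \<open>A\<close> to \<open>X'_s\<close> has a left inverse \<open>h\<close>,
  and \<open>\<tau> s\<close> after \<open>e\<close> factors through some \<open>q t\<close>. Hence
  that composite absorbs the idempotent \<open>i t\<close> after \<open>q t\<close>; cancelling
  \<open>\<tau> s\<close> and then applying \<open>h\<close>, the idempotent is the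
  identity.\<close>

lemma essentially_levelwise_monic_projectionD:
  assumes "essentially_levelwise V C M (projection w)" and M: "\<And>m. m \<in> M \<Longrightarrow> monic_in C m"
  shows "\<exists>t \<in> Field r. i t \<cdot>\<^bsub>C\<^esub> q t = Ident C A"
proof -
  let ?X = "constant_pro C w A" and ?Y = quotients and ?P = "pro_category V C"
  note Y = quotients_in_pro_objects
  obtain X' Y' \<tau> where level: "level_representation V C (projection w) X' Y' \<tau>"
    and \<tau>M: "\<And>s. s \<in> Obj (Shape X') \<Longrightarrow> \<tau> s \<in> M"
    using assms(1) unfolding essentially_levelwise_def by blast
  have P [simp]: "Comp ?P = pro_comp C" "Dom ?P = (\<lambda>(X, Y, \<phi>). X)" "Cod ?P = (\<lambda>(X, Y, \<phi>). Y)" "Obj ?P = pro_objects V C"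
    "Ident ?P X = pro_of_nat C X X (\<lambda>s. Ident C (ObM X s))" for X
    by (simp_all add: pro_category_def)
  have X': "X' \<in> pro_objects V C" and Y': "Y' \<in> pro_objects V C" and \<tau>: "natural_transformation C X' Y' \<tau>"
    using level by (simp_all add: level_representation_def Let_def)
  obtain a b where a: "a \<in> Hom ?P ?X X'" "iso_in ?P a" and b: "b \<in> Hom ?P ?Y Y'"
    and eq: "pro_comp C b (projection w) = pro_comp C (pro_of_nat C X' Y' \<tau>) a"
    using level unfolding level_representation_def Let_def P projection_def prod.case by blast
  obtain \<alpha> where a_eq: "a = (?X, X', \<alpha>)" and \<alpha>: "\<alpha> \<in> pro_Hom C ?X X'"
    using in_pro_HomE[OF a(1)] by metis
  obtain \<beta> where b_eq: "b = (?Y, Y', \<beta>)" and \<beta>: "\<beta> \<in> pro_Hom C ?Y Y'"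
    using in_pro_HomE[OF b] by metis
  obtain a' where a': "a' \<in> Hom ?P X' ?X"
    and a'a: "pro_comp C a' a = pro_of_nat C ?X ?X (\<lambda>s. Ident C (ObM ?X s))"
    using a(2) unfolding iso_in_def inverse_arrows_def P a_eq prod.case by metis
  obtain \<alpha>' where a'_eq: "a' = (X', ?X, \<alpha>')" and \<alpha>': "\<alpha>' \<in> pro_Hom C X' ?X"
    using in_pro_HomE[OF a'] by metis
  have w: "w \<in> Obj (Shape ?X)"
    by simp
  \<comment> \<open>The level \<open>s\<close> is dictated by the inverse \<open>a'\<close>: its
    only component is represented by a map \<open>h\<close> from \<open>X'_s\<close> to
    \<open>A\<close>.\<close>
  obtain s h where sh: "(s, h) \<in> \<alpha>' w"
    using pro_Hom_nonempty[OF C X' \<alpha>' w] .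
  have s: "s \<in> Obj (Shape X')" and h: "h \<in> Hom C (ObM X' s) A"
    using pro_Hom_rep[OF C X' \<alpha>' w sh] by simp_all
  have S: "Shape X' = Shape Y'" and \<tau>s: "\<tau> s \<in> Hom C (ObM X' s) (ObM Y' s)" and s': "s \<in> Obj (Shape Y')"
    using \<tau> s unfolding natural_transformation_def by auto
  obtain w' e where we: "(w', e) \<in> \<alpha> s"
    using pro_Hom_nonempty[OF C const_A \<alpha> s] .
  have w': "w' = w" and e: "e \<in> Hom C A (ObM X' s)"
    using pro_Hom_rep(1,2)[OF C const_A \<alpha> s we] by simp_all
  have "colim_rel C ?X A `` {(w, h \<cdot>\<^bsub>C\<^esub> e)} = colim_rel C ?X A `` {(w, Ident C A)}"
    using pro_comp_class[OF C const_A X' \<alpha> \<alpha>' w sh we, of X' X'] a'a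
    unfolding a_eq a'_eq w' by (simp add: pro_of_nat_def)
  then have he: "h \<cdot>\<^bsub>C\<^esub> e = Ident C A"
    by (simp add: colim_rel_constant_pro[OF C] comp_in_Hom[OF C h e] ident_in_Hom[OF C A])
  \<comment> \<open>The isomorphism \<open>b\<close> determines the quotient: its component at
    \<open>s\<close> is represented at some index \<open>t\<close>.\<close>
  obtain t k where tk: "(t, k) \<in> \<beta> s"
    using pro_Hom_nonempty[OF C Y \<beta> s'] .
  have t: "t \<in> Field r" and k: "k \<in> Hom C (Q t) (ObM Y' s)"
    using pro_Hom_rep(1,2)[OF C Y \<beta> s' tk] by simp_all
  have "(s, \<tau> s) \<in> snd (snd (pro_of_nat C X' Y' \<tau>)) s"
    using equiv_class_self[OF equiv_colim_rel[OF C X']] s s' \<tau>s by (simp add: pro_of_nat_def colim_carrier_def)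
  note \<tau>e = pro_comp_class[OF C const_A X' \<alpha> pro_of_nat_in_Hom[OF C X' Y' \<tau>] s' this we, of X' X']
  have "(X', Y', snd (snd (pro_of_nat C X' Y' \<tau>))) = pro_of_nat C X' Y' \<tau>"
    by (simp add: pro_of_nat_def)
  then have "snd (snd (pro_comp C (pro_of_nat C X' Y' \<tau>) a)) s = colim_rel C ?X (ObM Y' s) `` {(w, \<tau> s \<cdot>\<^bsub>C\<^esub> e)}"
    using \<tau>e unfolding a_eq w' by simp
  moreover have "(w, q t) \<in> (\<lambda>t \<in> Field r. {(w, q t)}) t"
    using t by simp
  from pro_comp_class[OF C const_A Y projection_in_pro_Hom \<beta> s' tk this]
  have "snd (snd (pro_comp C (pro_of_nat C X' Y' \<tau>) a)) s = colim_rel C ?X (ObM Y' s) `` {(w, k \<cdot>\<^bsub>C\<^esub> q t)}"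
    unfolding eq[symmetric] b_eq projection_def .
  ultimately have \<tau>e: "\<tau> s \<cdot>\<^bsub>C\<^esub> e = k \<cdot>\<^bsub>C\<^esub> q t"
    by (simp add: colim_rel_constant_pro[OF C] comp_in_Hom[OF C \<tau>s e] comp_in_Hom[OF C k q[OF t]])
  have iq: "i t \<cdot>\<^bsub>C\<^esub> q t \<in> Hom C A A"
    using comp_in_Hom[OF C i[OF t] q[OF t]] .
  have "(t, t) \<in> r"
    using refl_r t by (rule refl_onD)
  \<comment> \<open>By \<open>\<tau>e\<close> the composite ends in \<open>q t\<close>, and
    \<open>q t\<close> absorbs its own idempotent; this is \<open>comp_refine\<close> for the pair
    \<open>(t, t)\<close>.\<close>
  then have "\<tau> s \<cdot>\<^bsub>C\<^esub> (e \<cdot>\<^bsub>C\<^esub> (i t \<cdot>\<^bsub>C\<^esub> q t)) = \<tau> s \<cdot>\<^bsub>C\<^esub> e"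
    using comp_assoc[OF C iq e \<tau>s] comp_refine[OF _ k] \<tau>e by simp
  moreover have "monic_in C (\<tau> s)" "Dom C (\<tau> s) = ObM X' s"
    using M[OF \<tau>M[OF s]] \<tau>s by (simp_all add: Hom_def)
  ultimately have "e \<cdot>\<^bsub>C\<^esub> (i t \<cdot>\<^bsub>C\<^esub> q t) = e"
    using A e comp_in_Hom[OF C e iq] unfolding monic_in_def by metis
  then have "(h \<cdot>\<^bsub>C\<^esub> e) \<cdot>\<^bsub>C\<^esub> (i t \<cdot>\<^bsub>C\<^esub> q t) = h \<cdot>\<^bsub>C\<^esub> e"
    using comp_assoc[OF C iq e h] by simp
  then have "i t \<cdot>\<^bsub>C\<^esub> q t = Ident C A"
    using he ident_comp[OF C iq] by simp
  then show ?thesis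
    using t by blast
qed

end

section \<open>Discrete simplicial sets\<close>

lemma in_functor_category_Hom_iff:
  "f \<in> Hom (functor_category I C) X Y \<longleftrightarrow>
     (\<exists>\<tau>. f = (X, Y, \<tau>) \<and> Shape X = I \<and> Shape Y = I \<and> is_functor C X \<and> is_functor C Y \<and>
        natural_transformation C X Y \<tau> \<and> \<tau> \<in> extensional (Obj I))"
  by (cases f) (auto simp: Hom_def functor_category_def)

lemma natural_Shape: "natural_transformation C X Y \<tau> \<Longrightarrow> Shape Y = Shape X"
  by (simp add: natural_transformation_def)

lemma natural_Hom:
  "natural_transformation C X Y \<tau> \<Longrightarrow> s \<in> Obj (Shape X) \<Longrightarrow> \<tau> s \<in> Hom C (ObM X s) (ObM Y s)"
  by (simp add: natural_transformation_def)

lemma natural_comm: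
  "natural_transformation C X Y \<tau> \<Longrightarrow> a \<in> Hom (Shape X) s t \<Longrightarrow>
   ArM Y a \<cdot>\<^bsub>C\<^esub> \<tau> s = \<tau> t \<cdot>\<^bsub>C\<^esub> ArM X a"
  by (auto simp: natural_transformation_def Hom_def)

lemma natural_transformationI:
  assumes "is_category (Shape X)" "Shape Y = Shape X"
    and "\<And>s. s \<in> Obj (Shape X) \<Longrightarrow> \<tau> s \<in> Hom C (ObM X s) (ObM Y s)"
    and "\<And>a s t. a \<in> Hom (Shape X) s t \<Longrightarrow> s \<in> Obj (Shape X) \<Longrightarrow> t \<in> Obj (Shape X) \<Longrightarrow>
      ArM Y a \<cdot>\<^bsub>C\<^esub> \<tau> s = \<tau> t \<cdot>\<^bsub>C\<^esub> ArM X a"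
  shows "natural_transformation C X Y \<tau>"
  unfolding natural_transformation_def
proof (intro conjI ballI)
  fix a assume "a \<in> Arr (Shape X)"
  then have a: "a \<in> Hom (Shape X) (Dom (Shape X) a) (Cod (Shape X) a)"
    by (simp add: Hom_def)
  show "ArM Y a \<cdot>\<^bsub>C\<^esub> \<tau> (Dom (Shape X) a) = \<tau> (Cod (Shape X) a) \<cdot>\<^bsub>C\<^esub> ArM X a"
    using assms(4)[OF a Dom_in_Obj[OF assms(1) a] Cod_in_Obj[OF assms(1) a]] .
qed (use assms in simp_all)

lemma natural_transformation_comp:
  assumes C: "is_category C" and X: "is_functor C X" and Y: "is_functor C Y" and Z: "is_functor C Z"
    and \<tau>: "natural_transformation C X Y \<tau>" and \<sigma>: "natural_transformation C Y Z \<sigma>"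
  shows "natural_transformation C X Z (\<lambda>s \<in> Obj (Shape X). \<sigma> s \<cdot>\<^bsub>C\<^esub> \<tau> s)"
proof (rule natural_transformationI)
  note S = natural_Shape[OF \<tau>] natural_Shape[OF \<sigma>]
  note T = natural_Hom[OF \<tau>] and U = natural_Hom[OF \<sigma>, unfolded S]
  show "is_category (Shape X)"
    using X by (simp add: is_functor_def)
  show "Shape Z = Shape X"
    using S by simp
  show "(\<lambda>s \<in> Obj (Shape X). \<sigma> s \<cdot>\<^bsub>C\<^esub> \<tau> s) s \<in> Hom C (ObM X s) (ObM Z s)"
    if "s \<in> Obj (Shape X)" for s
    using that comp_in_Hom[OF C U[OF that] T[OF that]] by simp
  fix a s t assume a: "a \<in> Hom (Shape X) s t" and s: "s \<in> Obj (Shape X)" and t: "t \<in> Obj (Shape X)"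
  have aY: "a \<in> Hom (Shape Y) s t" and aZ: "a \<in> Hom (Shape Z) s t"
    using a S by simp_all
  note Xa = functor_Hom[OF X a] and Ya = functor_Hom[OF Y aY] and Za = functor_Hom[OF Z aZ]
  have "ArM Z a \<cdot>\<^bsub>C\<^esub> (\<sigma> s \<cdot>\<^bsub>C\<^esub> \<tau> s) = (\<sigma> t \<cdot>\<^bsub>C\<^esub> ArM Y a) \<cdot>\<^bsub>C\<^esub> \<tau> s"
    using comp_assoc[OF C T[OF s] U[OF s] Za] natural_comm[OF \<sigma> aY] by simp
  also have "\<dots> = (\<sigma> t \<cdot>\<^bsub>C\<^esub> \<tau> t) \<cdot>\<^bsub>C\<^esub> ArM X a"
    using comp_assoc[OF C T[OF s] Ya U[OF t]] natural_comm[OF \<tau> a] comp_assoc[OF C Xa T[OF t] U[OF t]]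
    by simp
  finally show "ArM Z a \<cdot>\<^bsub>C\<^esub> (\<lambda>s \<in> Obj (Shape X). \<sigma> s \<cdot>\<^bsub>C\<^esub> \<tau> s) s =
      (\<lambda>s \<in> Obj (Shape X). \<sigma> s \<cdot>\<^bsub>C\<^esub> \<tau> s) t \<cdot>\<^bsub>C\<^esub> ArM X a"
    using s t by simp
qed

lemma is_category_functor_category:
  assumes I: "is_category I" and C: "is_category C"
  shows "is_category (functor_category I C)"
proof -
  let ?F = "functor_category I C"
  have comp: "(Y', Z, \<sigma>) \<cdot>\<^bsub>?F\<^esub> (X, Y, \<tau>) = (X, Z, \<lambda>s \<in> Obj I. \<sigma> s \<cdot>\<^bsub>C\<^esub> \<tau> s)" for X Y Y' Z \<sigma> \<tau>
    by (simp add: functor_category_def)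
  have nat: "\<tau> s \<in> Hom C (ObM X s) (ObM Y s)" if "(X, Y, \<tau>) \<in> Hom ?F X Y" "s \<in> Obj I" for X Y \<tau> s
    using that by (auto simp: in_functor_category_Hom_iff intro: natural_Hom)
  have ext: "\<tau> \<in> extensional (Obj I)" if "(X, Y, \<tau>) \<in> Hom ?F X Y" for X Y \<tau>
    using that by (simp add: in_functor_category_Hom_iff)
  have comp_Hom: "g \<cdot>\<^bsub>?F\<^esub> f \<in> Hom ?F X Z" if f: "f \<in> Hom ?F X Y" and g: "g \<in> Hom ?F Y Z" for f g X Y Z
  proof -
    obtain \<tau> where \<tau>: "f = (X, Y, \<tau>)" "Shape X = I" "is_functor C X" "is_functor C Y"
      "natural_transformation C X Y \<tau>"
      using f unfolding in_functor_category_Hom_iff by blast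
    obtain \<sigma> where \<sigma>: "g = (Y, Z, \<sigma>)" "Shape Z = I" "is_functor C Z" "natural_transformation C Y Z \<sigma>"
      using g unfolding in_functor_category_Hom_iff by blast
    show ?thesis
      using natural_transformation_comp[OF C \<tau>(3,4) \<sigma>(3) \<tau>(5) \<sigma>(4)] \<tau>(2,3) \<sigma>(2,3)
      unfolding \<tau>(1) \<sigma>(1) comp in_functor_category_Hom_iff by simp
  qed
  have Hom_iff: "f \<in> Arr ?F \<longleftrightarrow> f \<in> Hom ?F (Dom ?F f) (Cod ?F f)" for f
    by (simp add: Hom_def)
  have ident: "f \<cdot>\<^bsub>?F\<^esub> Ident ?F X = f" "Ident ?F Y \<cdot>\<^bsub>?F\<^esub> f = f" if f: "f \<in> Hom ?F X Y" for f X Y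
  proof -
    obtain \<tau> where f_eq: "f = (X, Y, \<tau>)"
      using f unfolding in_functor_category_Hom_iff by blast
    note nat = nat[OF f[unfolded f_eq]] and ext = ext[OF f[unfolded f_eq]]
    have I_eq: "Ident ?F X = (X, X, \<lambda>s \<in> Obj I. Ident C (ObM X s))" for X
      by (simp add: functor_category_def)
    have "(\<lambda>s \<in> Obj I. \<tau> s \<cdot>\<^bsub>C\<^esub> (\<lambda>s \<in> Obj I. Ident C (ObM X s)) s) = \<tau>"
      "(\<lambda>s \<in> Obj I. (\<lambda>s \<in> Obj I. Ident C (ObM Y s)) s \<cdot>\<^bsub>C\<^esub> \<tau> s) = \<tau>"
      by (rule extensionalityI[OF _ ext]; simp add: comp_ident[OF C nat] ident_comp[OF C nat])+
    then show "f \<cdot>\<^bsub>?F\<^esub> Ident ?F X = f" "Ident ?F Y \<cdot>\<^bsub>?F\<^esub> f = f"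
      unfolding f_eq I_eq comp by simp_all
  qed
  have assoc: "h \<cdot>\<^bsub>?F\<^esub> (g \<cdot>\<^bsub>?F\<^esub> f) = (h \<cdot>\<^bsub>?F\<^esub> g) \<cdot>\<^bsub>?F\<^esub> f"
    if f: "f \<in> Hom ?F W X" and g: "g \<in> Hom ?F X Y" and h: "h \<in> Hom ?F Y Z" for f g h W X Y Z
  proof -
    obtain \<tau> \<sigma> \<rho> where eqs: "f = (W, X, \<tau>)" "g = (X, Y, \<sigma>)" "h = (Y, Z, \<rho>)"
      using f g h unfolding in_functor_category_Hom_iff by blast
    show ?thesis
      unfolding eqs comp
      using comp_assoc[OF C nat[OF f[unfolded eqs]] nat[OF g[unfolded eqs]] nat[OF h[unfolded eqs]]]
      by (auto intro!: restrict_ext)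
  qed
  show ?thesis
    unfolding is_category_def
  proof (intro conjI ballI impI)
    fix f assume f: "f \<in> Arr ?F"
    show "Dom ?F f \<in> Obj ?F" "Cod ?F f \<in> Obj ?F"
      using f by (auto simp: functor_category_def)
    show "f \<cdot>\<^bsub>?F\<^esub> Ident ?F (Dom ?F f) = f" "Ident ?F (Cod ?F f) \<cdot>\<^bsub>?F\<^esub> f = f"
      using ident f Hom_iff by blast+
  next
    fix X assume "X \<in> Obj ?F"
    then have X: "Shape X = I" "is_functor C X"
      by (simp_all add: functor_category_def)
    have "natural_transformation C X X (\<lambda>s \<in> Obj I. Ident C (ObM X s))"
    proof (rule natural_transformationI)
      fix a s t assume a: "a \<in> Hom (Shape X) s t" and "s \<in> Obj (Shape X)" "t \<in> Obj (Shape X)"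
      then show "ArM X a \<cdot>\<^bsub>C\<^esub> (\<lambda>s \<in> Obj I. Ident C (ObM X s)) s =
          (\<lambda>s \<in> Obj I. Ident C (ObM X s)) t \<cdot>\<^bsub>C\<^esub> ArM X a"
        using X(1) comp_ident[OF C functor_Hom[OF X(2) a]] ident_comp[OF C functor_Hom[OF X(2) a]]
        by simp
    qed (use X I ident_in_Hom[OF C functor_Obj[OF X(2)]] in simp_all)
    then show "Ident ?F X \<in> Hom ?F X X"
      using X by (simp add: functor_category_def Hom_def)
  next
    fix f g assume "f \<in> Arr ?F" "g \<in> Arr ?F" "Dom ?F g = Cod ?F f"
    then show "g \<cdot>\<^bsub>?F\<^esub> f \<in> Hom ?F (Dom ?F f) (Cod ?F g)"
      using comp_Hom Hom_iff by metis
    fix h assume "h \<in> Arr ?F" "Dom ?F h = Cod ?F g"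
    then show "h \<cdot>\<^bsub>?F\<^esub> (g \<cdot>\<^bsub>?F\<^esub> f) = (h \<cdot>\<^bsub>?F\<^esub> g) \<cdot>\<^bsub>?F\<^esub> f"
      using assoc Hom_iff \<open>f \<in> Arr ?F\<close> \<open>g \<in> Arr ?F\<close> \<open>Dom ?F g = Cod ?F f\<close> by metis
  qed
qed

section \<open>Simplicial sets and simplicial maps in terms of elements\<close>

lemma is_category_set_category: "is_category (set_category V)"
  unfolding is_category_def set_category_def Hom_def
  by (auto simp: compose_assoc compose_def PiE_iff extensional_def fun_eq_iff)

lemma is_category_op_simplex_category: "is_category (op_category simplex_category)"
  unfolding is_category_def simplex_category_def op_category_def Hom_def
  by (auto simp: compose_def PiE_iff extensional_def fun_eq_iff mono_on_def)

lemma sset_model_simps [simp]: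
  "Obj (sset_model V) = Obj (sset_category V)" "Arr (sset_model V) = Arr (sset_category V)"
  "Dom (sset_model V) = Dom (sset_category V)" "Cod (sset_model V) = Cod (sset_category V)"
  "Ident (sset_model V) = Ident (sset_category V)" "Comp (sset_model V) = Comp (sset_category V)"
  "Cofib (sset_model V) = {f. monic_in (sset_category V) f}"
  by (simp_all add: sset_model_def category.defs)

lemma is_category_sset_category: "is_category (sset_category V)"
  unfolding sset_category_def
  by (rule is_category_functor_category[OF is_category_op_simplex_category is_category_set_category])

lemma Hom_sset_model [simp]: "Hom (sset_model V) X Y = Hom (sset_category V) X Y"
  by (simp add: Hom_def)

lemma is_category_sset_model: "is_category (sset_model V)"
  using is_category_sset_category[of V] unfolding is_category_def by simp

lemma sset_ArM:
  assumes X: "X \<in> Obj (sset_category V)" and \<theta>: "(m, n, \<theta>) \<in> Arr simplex_category"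
  shows "ArM X (m, n, \<theta>) = (ObM X n, ObM X m, sset_op X (m, n, \<theta>))"
    and "sset_op X (m, n, \<theta>) \<in> ObM X n \<rightarrow>\<^sub>E ObM X m"
proof -
  have "Shape X = op_category simplex_category" "is_functor (set_category V) X"
    using X by (simp_all add: sset_category_def functor_category_def)
  moreover have "(m, n, \<theta>) \<in> Hom (op_category simplex_category) n m"
    using \<theta> by (simp add: Hom_def op_category_def) (simp add: simplex_category_def)
  ultimately have "ArM X (m, n, \<theta>) \<in> Hom (set_category V) (ObM X n) (ObM X m)"
    using functor_Hom by metis
  then show "ArM X (m, n, \<theta>) = (ObM X n, ObM X m, sset_op X (m, n, \<theta>))"
    and "sset_op X (m, n, \<theta>) \<in> ObM X n \<rightarrow>\<^sub>E ObM X m"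
    by (cases "ArM X (m, n, \<theta>)"; auto simp: Hom_def set_category_def sset_op_def)+
qed

lemma sset_small:
  assumes "X \<in> Obj (sset_category V)"
  shows "small V (ObM X n)"
proof -
  have "n \<in> Obj (op_category simplex_category)"
    by (simp add: op_category_def simplex_category_def)
  then have "ObM X n \<in> Obj (set_category V)"
    using assms functor_Obj by (fastforce simp: sset_category_def functor_category_def)
  then show ?thesis
    by (simp add: set_category_def)
qed

lemma sset_op_comp:
  assumes X: "X \<in> Obj (sset_category V)"
    and \<theta>: "(m, n, \<theta>) \<in> Arr simplex_category" and \<eta>: "(n, k, \<eta>) \<in> Arr simplex_category"
    and x: "x \<in> ObM X k"
  shows "sset_op X (m, n, \<theta>) (sset_op X (n, k, \<eta>) x) = sset_op X (m, k, compose {..m} \<eta> \<theta>) x"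
proof -
  have F: "Shape X = op_category simplex_category" "is_functor (set_category V) X"
    using X by (simp_all add: sset_category_def functor_category_def)
  have H: "(m, n, \<theta>) \<in> Hom (Shape X) n m" "(n, k, \<eta>) \<in> Hom (Shape X) k n"
    using \<theta> \<eta> by (simp_all add: F(1) Hom_def op_category_def) (simp_all add: simplex_category_def)
  have "(m, n, \<theta>) \<cdot>\<^bsub>Shape X\<^esub> (n, k, \<eta>) = (m, k, compose {..m} \<eta> \<theta>)"
    by (simp add: F(1) op_category_def simplex_category_def)
  then have "ArM X (m, k, compose {..m} \<eta> \<theta>) = ArM X (m, n, \<theta>) \<cdot>\<^bsub>set_category V\<^esub> ArM X (n, k, \<eta>)"
    using functor_comp[OF F(2) H(2,1)] by simp
  then have "sset_op X (m, k, compose {..m} \<eta> \<theta>) =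
      compose (ObM X k) (sset_op X (m, n, \<theta>)) (sset_op X (n, k, \<eta>))"
    unfolding sset_op_def[of X "(m, k, compose {..m} \<eta> \<theta>)"]
    by (simp add: sset_ArM(1)[OF X \<theta>] sset_ArM(1)[OF X \<eta>] set_category_def)
  then show ?thesis
    using x by (simp add: compose_def)
qed

lemma sset_op_ident:
  assumes X: "X \<in> Obj (sset_category V)" and x: "x \<in> ObM X n"
  shows "sset_op X (n, n, \<lambda>i \<in> {..n}. i) x = x"
proof -
  have F: "Shape X = op_category simplex_category" "is_functor (set_category V) X"
    using X by (simp_all add: sset_category_def functor_category_def)
  have "ArM X (Ident (Shape X) n) = Ident (set_category V) (ObM X n)"
    using F(2) by (rule functor_ident) (simp add: F(1) op_category_def simplex_category_def)
  then have "ArM X (n, n, \<lambda>i \<in> {..n}. i) = Ident (set_category V) (ObM X n)"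
    by (simp add: F(1) op_category_def simplex_category_def)
  then show ?thesis
    using x by (simp add: sset_op_def set_category_def)
qed

lemma in_sset_HomE:
  assumes "f \<in> Hom (sset_category V) X Y"
  obtains \<tau> where "f = (X, Y, \<tau>)" "X \<in> Obj (sset_category V)" "Y \<in> Obj (sset_category V)"
    "\<And>n. \<tau> n = (ObM X n, ObM Y n, sset_apply f n)"
    "\<And>n. sset_apply f n \<in> ObM X n \<rightarrow>\<^sub>E ObM Y n"
    "\<And>m n \<theta> x. (m, n, \<theta>) \<in> Arr simplex_category \<Longrightarrow> x \<in> ObM X n \<Longrightarrow>
       sset_op Y (m, n, \<theta>) (sset_apply f n x) = sset_apply f m (sset_op X (m, n, \<theta>) x)"
proof -
  obtain \<tau> where f: "f = (X, Y, \<tau>)" and X: "X \<in> Obj (sset_category V)" and Y: "Y \<in> Obj (sset_category V)"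
    and S: "Shape X = op_category simplex_category" and nat: "natural_transformation (set_category V) X Y \<tau>"
    using assms unfolding sset_category_def in_functor_category_Hom_iff
    by (auto simp: functor_category_def)
  have \<tau>_Hom: "\<tau> n \<in> Hom (set_category V) (ObM X n) (ObM Y n)" for n
    using nat S by (simp add: natural_transformation_def op_category_def simplex_category_def)
  have \<tau>: "\<tau> n = (ObM X n, ObM Y n, sset_apply f n)" "sset_apply f n \<in> ObM X n \<rightarrow>\<^sub>E ObM Y n" for n
  proof -
    obtain A B h where "\<tau> n = (A, B, h)"
      by (rule prod_cases3)
    then show "\<tau> n = (ObM X n, ObM Y n, sset_apply f n)" "sset_apply f n \<in> ObM X n \<rightarrow>\<^sub>E ObM Y n"
      using \<tau>_Hom[of n] by (auto simp: f Hom_def set_category_def sset_apply_def)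
  qed
  have "sset_op Y (m, n, \<theta>) (sset_apply f n x) = sset_apply f m (sset_op X (m, n, \<theta>) x)"
    if \<theta>: "(m, n, \<theta>) \<in> Arr simplex_category" and x: "x \<in> ObM X n" for m n \<theta> x
  proof -
    have "ArM Y (m, n, \<theta>) \<cdot>\<^bsub>set_category V\<^esub> \<tau> n = \<tau> m \<cdot>\<^bsub>set_category V\<^esub> ArM X (m, n, \<theta>)"
      using nat \<theta> unfolding natural_transformation_def S by (auto simp: op_category_def simplex_category_def)
    then have "compose (ObM X n) (sset_op Y (m, n, \<theta>)) (sset_apply f n) =
        compose (ObM X n) (sset_apply f m) (sset_op X (m, n, \<theta>))"
      by (simp add: sset_ArM(1)[OF X \<theta>] sset_ArM(1)[OF Y \<theta>] \<tau>(1) set_category_def)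
    from fun_cong[OF this, of x] show ?thesis
      using x by (simp add: compose_def)
  qed
  then show thesis
    using that[OF f X Y \<tau>] by blast
qed

lemma sset_apply_comp:
  assumes f: "f \<in> Hom (sset_category V) X Y" and g: "g \<in> Hom (sset_category V) Y Z" and x: "x \<in> ObM X n"
  shows "sset_apply (g \<cdot>\<^bsub>sset_category V\<^esub> f) n x = sset_apply g n (sset_apply f n x)"
proof -
  obtain \<tau> where \<tau>: "f = (X, Y, \<tau>)" "\<And>n. \<tau> n = (ObM X n, ObM Y n, sset_apply f n)"
    using in_sset_HomE[OF f] by metis
  obtain \<sigma> where \<sigma>: "g = (Y, Z, \<sigma>)" "\<And>n. \<sigma> n = (ObM Y n, ObM Z n, sset_apply g n)"
    using in_sset_HomE[OF g] by metis
  have "g \<cdot>\<^bsub>sset_category V\<^esub> f = (X, Z, \<lambda>n. (ObM X n, ObM Z n, compose (ObM X n) (sset_apply g n) (sset_apply f n)))"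
    by (subst \<tau>(1), subst \<sigma>(1))
      (simp add: sset_category_def functor_category_def op_category_def simplex_category_def \<tau>(2) \<sigma>(2) set_category_def fun_eq_iff)
  then show ?thesis
    using x by (simp add: sset_apply_def compose_def)
qed

lemma sset_apply_ident:
  assumes "x \<in> ObM X n"
  shows "sset_apply (Ident (sset_category V) X) n x = x"
  using assms
  by (simp add: sset_apply_def sset_category_def functor_category_def op_category_def
      simplex_category_def set_category_def)

text \<open>The functor \<open>discrete\<close> is left adjoint to taking vertices. For this reason
  the cardinal bounds below involve only the vertex sets of a pro-object.\<close>

definition discrete :: "'v set \<Rightarrow> 'v sset" where
  "discrete S = \<lparr>Shape = op_category simplex_category, ObM = (\<lambda>_. S), ArM = (\<lambda>_. (S, S, \<lambda>x \<in> S. x))\<rparr>"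

text \<open>The map induced by \<open>g : S \<rightarrow> X_0\<close>; it sends \<open>x\<close> to the degenerate \<open>n\<close>-simplex on the vertex \<open>g x\<close>.\<close>

definition discrete_map :: "'v set \<Rightarrow> 'v sset \<Rightarrow> ('v \<Rightarrow> 'v) \<Rightarrow> 'v sset_map" where
  "discrete_map S X g =
     (discrete S, X, \<lambda>n. (S, ObM X n, \<lambda>x \<in> S. sset_op X (n, 0, \<lambda>i \<in> {..n}. 0) (g x)))"

lemma ObM_discrete [simp]: "ObM (discrete S) n = S"
  by (simp add: discrete_def)

lemma const_in_Arr_simplex: "(n, 0, \<lambda>i \<in> {..n}. 0) \<in> Arr simplex_category"
  by (auto simp: simplex_category_def mono_on_def)

lemma discrete_in_Obj:
  assumes "small V S"
  shows "discrete S \<in> Obj (sset_category V)"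
proof -
  have "is_functor (set_category V) (discrete S)"
    using assms is_category_op_simplex_category
    by (auto simp: is_functor_def discrete_def set_category_def Hom_def compose_def)
  then show ?thesis
    by (simp add: sset_category_def functor_category_def) (simp add: discrete_def)
qed

lemma discrete_map_in_Hom:
  assumes S: "small V S" and X: "X \<in> Obj (sset_category V)" and g: "g \<in> S \<rightarrow> ObM X 0"
  shows "discrete_map S X g \<in> Hom (sset_category V) (discrete S) X"
proof -
  let ?c = "\<lambda>n. sset_op X (n, 0, \<lambda>i \<in> {..n}. 0)"
  define \<tau> where "\<tau> = (\<lambda>n. (S, ObM X n, \<lambda>x \<in> S. ?c n (g x)))"
  have c: "?c n (g x) \<in> ObM X n" if "x \<in> S" for n x
    using sset_ArM(2)[OF X const_in_Arr_simplex, of n] g that by auto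
  have D: "Shape X = op_category simplex_category" "Shape (discrete S) = op_category simplex_category"
    using X by (simp_all add: sset_category_def functor_category_def discrete_def)
  have "natural_transformation (set_category V) (discrete S) X \<tau>"
    unfolding natural_transformation_def D
  proof (intro conjI ballI refl)
    fix n
    show "\<tau> n \<in> Hom (set_category V) (ObM (discrete S) n) (ObM X n)"
      using S sset_small[OF X] c by (simp add: \<tau>_def Hom_def set_category_def)
  next
    fix a assume "a \<in> Arr (op_category simplex_category)"
    then obtain m n \<theta> where a: "a = (m, n, \<theta>)" and \<theta>: "(m, n, \<theta>) \<in> Arr simplex_category"
      by (cases a) (simp add: op_category_def)
    \<comment> \<open>The object \<open>[0]\<close> is terminal in the simplex category, so the
      operators from vertices to degenerate simplices are compatible with every
      \<open>\<theta>\<close>.\<close>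
    have "compose {..m} (\<lambda>i \<in> {..n}. 0) \<theta> = (\<lambda>i \<in> {..m}. 0 :: nat)"
      using \<theta> by (auto simp: compose_def simplex_category_def fun_eq_iff)
    then have "sset_op X (m, n, \<theta>) (?c n (g x)) = ?c m (g x)" if "x \<in> S" for x
      using sset_op_comp[OF X \<theta> const_in_Arr_simplex funcset_mem[OF g that]] by simp
    then have "compose S (sset_op X (m, n, \<theta>)) (\<lambda>x \<in> S. ?c n (g x)) =
        compose S (\<lambda>x \<in> S. ?c m (g x)) (\<lambda>x \<in> S. x)"
      by (auto simp: compose_def fun_eq_iff)
    then have "ArM X a \<cdot>\<^bsub>set_category V\<^esub> \<tau> n = \<tau> m \<cdot>\<^bsub>set_category V\<^esub> ArM (discrete S) a"
      by (simp add: a sset_ArM(1)[OF X \<theta>] \<tau>_def discrete_def set_category_def)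
    then show "ArM X a \<cdot>\<^bsub>set_category V\<^esub> \<tau> (Dom (op_category simplex_category) a) =
        \<tau> (Cod (op_category simplex_category) a) \<cdot>\<^bsub>set_category V\<^esub> ArM (discrete S) a"
      by (simp add: a op_category_def simplex_category_def)
  qed
  then have "(discrete S, X, \<tau>) \<in> Hom (sset_category V) (discrete S) X"
    using X discrete_in_Obj[OF S] D
    unfolding sset_category_def in_functor_category_Hom_iff
    by (simp add: functor_category_def op_category_def simplex_category_def extensional_def)
  then show ?thesis
    by (simp add: discrete_map_def \<tau>_def)
qed

lemma sset_apply_discrete_map:
  assumes X: "X \<in> Obj (sset_category V)" and g: "g \<in> S \<rightarrow> ObM X 0" and x: "x \<in> S"
  shows "sset_apply (discrete_map S X g) 0 x = g x"
proof -
  \<comment> \<open>In degree 0 the degeneracy operator is the identity operator.\<close>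
  have "(\<lambda>i \<in> {..0}. 0) = (\<lambda>i \<in> {..0::nat}. i)"
    by auto
  then show ?thesis
    using sset_op_ident[OF X, of "g x" 0] g x by (auto simp: sset_apply_def discrete_map_def)
qed

text \<open>Every simplex of a discrete simplicial set is degenerate on a vertex; naturality along
  \<open>[n] -> [0]\<close> therefore determines the map in degree \<open>n\<close> by its values on
  vertices.\<close>

lemma discrete_map_eqI:
  assumes f: "f \<in> Hom (sset_category V) (discrete S) X" and g: "g \<in> Hom (sset_category V) (discrete S) X"
    and eq: "\<And>x. x \<in> S \<Longrightarrow> sset_apply f 0 x = sset_apply g 0 x"
  shows "f = g"
proof -
  have *: "f = discrete_map S X (sset_apply f 0)" if f: "f \<in> Hom (sset_category V) (discrete S) X" for f
  proof -
    obtain \<tau> where f_eq: "f = (discrete S, X, \<tau>)" and \<tau>: "\<And>n. \<tau> n = (S, ObM X n, sset_apply f n)"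
      and maps: "\<And>n. sset_apply f n \<in> S \<rightarrow>\<^sub>E ObM X n"
      and nat: "\<And>m n \<theta> x. (m, n, \<theta>) \<in> Arr simplex_category \<Longrightarrow> x \<in> S \<Longrightarrow>
         sset_op X (m, n, \<theta>) (sset_apply f n x) = sset_apply f m (sset_op (discrete S) (m, n, \<theta>) x)"
      using in_sset_HomE[OF f] unfolding ObM_discrete by metis
    have app: "sset_apply f n = (\<lambda>x \<in> S. sset_op X (n, 0, \<lambda>i \<in> {..n}. 0) (sset_apply f 0 x))" for n
    proof (rule extensionalityI[of _ S])
      show "sset_apply f n \<in> extensional S"
        using maps by (simp add: PiE_def)
      fix x assume "x \<in> S"
      then show "sset_apply f n x = (\<lambda>x \<in> S. sset_op X (n, 0, \<lambda>i \<in> {..n}. 0) (sset_apply f 0 x)) x"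
        using nat[OF const_in_Arr_simplex, of x n] by (simp add: discrete_def sset_op_def)
    qed simp
    have "\<tau> = (\<lambda>n. (S, ObM X n, \<lambda>x \<in> S. sset_op X (n, 0, \<lambda>i \<in> {..n}. 0) (sset_apply f 0 x)))"
    proof (rule ext)
      fix n
      show "\<tau> n = (S, ObM X n, \<lambda>x \<in> S. sset_op X (n, 0, \<lambda>i \<in> {..n}. 0) (sset_apply f 0 x))"
        using \<tau>[of n] unfolding app[of n] .
    qed
    then show ?thesis
      using f_eq by (simp add: discrete_map_def)
  qed
  have "discrete_map S X (sset_apply f 0) = discrete_map S X (sset_apply g 0)"
    unfolding discrete_map_def using eq by (auto intro!: restrict_ext)
  then show ?thesis
    using *[OF f] *[OF g] by simp
qed

section \<open>Idempotents with small image\<close>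

text \<open>An idempotent stands for a quotient of \<open>A\<close> together with a section: its
  fibres are the classes and its image is a set of representatives. The quotient thus remains a
  subset of \<open>A\<close>, and extensionality makes all these functions a small set.\<close>

definition idempotents :: "'v set \<Rightarrow> ('v \<Rightarrow> 'v) set" where
  "idempotents A = {e \<in> A \<rightarrow>\<^sub>E A. (\<forall>x \<in> A. e (e x) = e x) \<and> |e ` A| <o |A|}"

lemma small_idempotents:
  assumes "inaccessible_universe V" "small V A"
  shows "small V (idempotents A)"
proof -
  have "small V (A \<rightarrow>\<^sub>E A)"
    using assms by (rule small_PiE) (rule assms(2))
  then show ?thesis
    by (rule small_subset) (auto simp: idempotents_def)
qed

text \<open>Choosing one point in each fibre of \<open>F\<close> gives \<open>e\<close>, so its
  image is no larger than that of \<open>F\<close>.\<close>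

lemma idempotent_with_kernel:
  fixes F :: "'v \<Rightarrow> 'b"
  assumes "|F ` A| <o |A|"
  obtains e where "e \<in> idempotents A" "\<And>x. x \<in> A \<Longrightarrow> F (e x) = F x"
proof -
  define e where "e = (\<lambda>x \<in> A. inv_into A F (F x))"
  have A: "e x \<in> A" and F: "F (e x) = F x" if "x \<in> A" for x
    using that by (simp_all add: e_def inv_into_into f_inv_into_f)
  have "e ` A \<subseteq> inv_into A F ` F ` A"
    by (auto simp: e_def)
  then have "|e ` A| \<le>o |F ` A|"
    by (meson card_of_image card_of_mono1 ordLeq_transitive)
  then have "|e ` A| <o |A|"
    using assms by (rule ordLeq_ordLess_trans)
  moreover have "e (e x) = e x" if "x \<in> A" for x
    using A[OF that] F[OF that] that by (simp add: e_def)
  moreover have "e \<in> A \<rightarrow>\<^sub>E A"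
    using A by (auto simp: e_def)
  ultimately show thesis
    using that F unfolding idempotents_def by blast
qed

text \<open>The pair of \<open>d\<close> and \<open>e\<close> takes values in a product of two sets
  smaller than the infinite set \<open>A\<close>, hence again fewer than \<open>|A|\<close> values;
  \<open>f\<close> selects a point in each of its fibres.\<close>

lemma idempotents_directed:
  assumes "infinite A" "d \<in> idempotents A" "e \<in> idempotents A"
  obtains f where "f \<in> idempotents A" "\<And>x. x \<in> A \<Longrightarrow> d (f x) = d x" "\<And>x. x \<in> A \<Longrightarrow> e (f x) = e x"
proof -
  have "(\<lambda>x. (d x, e x)) ` A \<subseteq> d ` A \<times> e ` A"
    by auto
  moreover have "|d ` A \<times> e ` A| <o |A|"
    using assms by (intro card_of_Times_less) (simp_all add: idempotents_def)
  ultimately have "|(\<lambda>x. (d x, e x)) ` A| <o |A|"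
    using card_of_mono1 ordLeq_ordLess_trans by blast
  then show thesis
    using idempotent_with_kernel[of "\<lambda>x. (d x, e x)" A] that by (metis prod.inject)
qed

section \<open>The system of quotients of \<open>A\<close> with fewer than \<open>|A|\<close>
  classes\<close>

context
  fixes V :: "'v itself" and A T :: "'v set" and enc :: "'v \<Rightarrow> 'v \<Rightarrow> 'v" and r :: "'v rel"
  assumes V: "inaccessible_universe V" and A: "small V A" "infinite A"
    and enc: "bij_betw enc T (idempotents A)"
    and r: "r = {(s, t) \<in> T \<times> T. \<forall>x \<in> A. enc s (enc t x) = enc s x}"
begin

lemma enc_idempotent: "t \<in> T \<Longrightarrow> enc t \<in> idempotents A"
  using enc by (auto simp: bij_betw_def)

lemma enc_in: "t \<in> T \<Longrightarrow> x \<in> A \<Longrightarrow> enc t x \<in> A"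
  using enc_idempotent by (auto simp: idempotents_def)

lemma enc_idem: "t \<in> T \<Longrightarrow> x \<in> A \<Longrightarrow> enc t (enc t x) = enc t x"
  using enc_idempotent by (auto simp: idempotents_def)

lemma obtain_index:
  assumes "e \<in> idempotents A"
  obtains t where "t \<in> T" "enc t = e"
proof -
  have "e \<in> enc ` T"
    using enc assms by (simp add: bij_betw_def)
  then show thesis
    using that by (elim imageE) simp
qed

lemma Field_index: "Field r = T"
  using enc_idem by (auto simp: r Field_def)

abbreviation "quo t \<equiv> discrete (enc t ` A)"
abbreviation "proj t \<equiv> discrete_map A (quo t) (enc t)"
abbreviation "incl t \<equiv> discrete_map (enc t ` A) (discrete A) id"

lemma small_image_enc: "small V (enc t ` A)"
  using A(1) by (rule small_image)

lemma proj_in_Hom: "proj t \<in> Hom (sset_category V) (discrete A) (quo t)"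
  using discrete_map_in_Hom[OF A(1) discrete_in_Obj[OF small_image_enc]] by simp

lemma incl_in_Hom: "t \<in> T \<Longrightarrow> incl t \<in> Hom (sset_category V) (quo t) (discrete A)"
  by (rule discrete_map_in_Hom[OF small_image_enc discrete_in_Obj[OF A(1)]]) (auto simp: enc_in)

lemma proj_apply: "x \<in> A \<Longrightarrow> sset_apply (proj t) 0 x = enc t x"
  by (rule sset_apply_discrete_map[OF discrete_in_Obj[OF small_image_enc]]) auto

lemma incl_apply:
  assumes "t \<in> T" "x \<in> enc t ` A"
  shows "sset_apply (incl t) 0 x = x"
proof -
  have "id \<in> enc t ` A \<rightarrow> ObM (discrete A) 0"
    using enc_in[OF assms(1)] by auto
  then show ?thesis
    using sset_apply_discrete_map[OF discrete_in_Obj[OF A(1)] _ assms(2)] by simp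
qed

lemma incl_comp_proj_in_Hom:
  "t \<in> T \<Longrightarrow> incl t \<cdot>\<^bsub>sset_category V\<^esub> proj t \<in> Hom (sset_category V) (discrete A) (discrete A)"
  using comp_in_Hom[OF is_category_sset_category incl_in_Hom proj_in_Hom] .

lemma incl_comp_proj_apply:
  assumes "t \<in> T" "x \<in> A"
  shows "sset_apply (incl t \<cdot>\<^bsub>sset_category V\<^esub> proj t) 0 x = enc t x"
  using sset_apply_comp[OF proj_in_Hom incl_in_Hom[OF assms(1)], of x 0]
  by (simp add: assms proj_apply incl_apply)

text \<open>Here \<open>(s, t) \<in> r\<close> means that \<open>enc s\<close> is constant on the
  fibres of \<open>enc t\<close>, i.e. the classes of \<open>t\<close> refine those of
  \<open>s\<close>. The equations between simplicial maps are checked on vertices.\<close>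

lemma split_idempotents_quotients:
  "split_idempotents V (sset_model V) (discrete A) r quo proj incl"
proof
  let ?S = "sset_category V"
  note S = is_category_sset_category[of V]
  show "inaccessible_universe V" "is_category (sset_model V)" "discrete A \<in> Obj (sset_model V)"
    using V is_category_sset_model discrete_in_Obj[OF A(1)] by simp_all
  show "refl_on (Field r) r"
    unfolding Field_index using enc_idem by (auto simp: refl_on_def r)
  show "trans r"
  proof (rule transI)
    fix s t u assume st: "(s, t) \<in> r" and tu: "(t, u) \<in> r"
    have "enc s (enc u x) = enc s x" if x: "x \<in> A" for x
    proof -
      have "enc u x \<in> A"
        using enc_in tu x by (simp add: r)
      then have "enc s (enc t (enc u x)) = enc s (enc u x)"
        using st by (simp add: r)
      moreover have "enc t (enc u x) = enc t x" "enc s (enc t x) = enc s x"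
        using tu st x by (simp_all add: r)
      ultimately show ?thesis
        by simp
    qed
    then show "(s, u) \<in> r"
      using st tu by (simp add: r)
  qed
  have "T = inv_into T enc ` idempotents A"
    using enc by (metis bij_betw_imp_surj_on bij_betw_inv_into)
  then have "small V T"
    using small_image[OF small_idempotents[OF V A(1)], of "inv_into T enc"] by simp
  then show "small V r"
    by (rule small_subset[OF small_Times[OF V \<open>small V T\<close>]]) (auto simp: r)
  show "\<exists>u. (s, u) \<in> r \<and> (t, u) \<in> r" if "s \<in> Field r" "t \<in> Field r" for s t
  proof -
    have st: "s \<in> T" "t \<in> T"
      using that by (simp_all add: Field_index)
    obtain f where f: "f \<in> idempotents A" "\<And>x. x \<in> A \<Longrightarrow> enc s (f x) = enc s x"
      "\<And>x. x \<in> A \<Longrightarrow> enc t (f x) = enc t x"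
      using idempotents_directed[OF A(2) enc_idempotent[OF st(1)] enc_idempotent[OF st(2)]] by blast
    obtain u where "u \<in> T" "enc u = f"
      using obtain_index[OF f(1)] .
    then show ?thesis
      using f st by (auto simp: r)
  qed
  \<comment> \<open>Collapsing \<open>A\<close> to a point shows that there is at least one
    index.\<close>
  have "|(\<lambda>_. ()) ` A| <o |A|"
    using A(2) by (intro finite_ordLess_infinite2) simp_all
  then obtain e where "e \<in> idempotents A"
    using idempotent_with_kernel by blast
  then obtain t where "t \<in> Field r"
    unfolding Field_index by (rule obtain_index)
  then show "r \<noteq> {}"
    by auto
  show "proj t \<in> Hom (sset_model V) (discrete A) (quo t)" for t
    using proj_in_Hom by simp
  show "incl t \<in> Hom (sset_model V) (quo t) (discrete A)" if "t \<in> Field r" for t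
    using incl_in_Hom that by (simp add: Field_index)
  show "proj t \<cdot>\<^bsub>sset_model V\<^esub> incl t = Ident (sset_model V) (quo t)" if "t \<in> Field r" for t
    unfolding sset_model_simps
  proof (rule discrete_map_eqI)
    have t: "t \<in> T"
      using that by (simp add: Field_index)
    show "proj t \<cdot>\<^bsub>?S\<^esub> incl t \<in> Hom ?S (quo t) (quo t)"
      using comp_in_Hom[OF S proj_in_Hom incl_in_Hom[OF t]] .
    show "Ident ?S (quo t) \<in> Hom ?S (quo t) (quo t)"
      using ident_in_Hom[OF S discrete_in_Obj[OF small_image_enc]] .
    fix x assume x: "x \<in> enc t ` A"
    then have "x \<in> A" "enc t x = x"
      using enc_in[OF t] enc_idem[OF t] by auto
    then show "sset_apply (proj t \<cdot>\<^bsub>?S\<^esub> incl t) 0 x = sset_apply (Ident ?S (quo t)) 0 x"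
      using x sset_apply_comp[OF incl_in_Hom[OF t] proj_in_Hom, of x 0]
      by (simp add: t proj_apply incl_apply sset_apply_ident)
  qed
  show "proj s \<cdot>\<^bsub>sset_model V\<^esub> (incl t \<cdot>\<^bsub>sset_model V\<^esub> proj t) = proj s" if st: "(s, t) \<in> r" for s t
    unfolding sset_model_simps
  proof (rule discrete_map_eqI)
    have t: "t \<in> T" and refine: "\<And>x. x \<in> A \<Longrightarrow> enc s (enc t x) = enc s x"
      using st by (simp_all add: r)
    show "proj s \<cdot>\<^bsub>?S\<^esub> (incl t \<cdot>\<^bsub>?S\<^esub> proj t) \<in> Hom ?S (discrete A) (quo s)"
      using comp_in_Hom[OF S proj_in_Hom incl_comp_proj_in_Hom[OF t]] .
    show "proj s \<in> Hom ?S (discrete A) (quo s)"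
      by (rule proj_in_Hom)
    fix x assume x: "x \<in> A"
    then show "sset_apply (proj s \<cdot>\<^bsub>?S\<^esub> (incl t \<cdot>\<^bsub>?S\<^esub> proj t)) 0 x = sset_apply (proj s) 0 x"
      using sset_apply_comp[OF incl_comp_proj_in_Hom[OF t] proj_in_Hom, of x 0] refine enc_in[OF t]
      by (simp add: t proj_apply incl_comp_proj_apply)
  qed
qed

text \<open>Otherwise the image of \<open>enc t\<close> would be all of \<open>A\<close>, against
  the strict bound in \<open>idempotents\<close>.\<close>

lemma incl_comp_proj_neq_ident:
  assumes t: "t \<in> T"
  shows "incl t \<cdot>\<^bsub>sset_category V\<^esub> proj t \<noteq> Ident (sset_category V) (discrete A)"
proof
  assume "incl t \<cdot>\<^bsub>sset_category V\<^esub> proj t = Ident (sset_category V) (discrete A)"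
  then have "enc t x = x" if "x \<in> A" for x
    using incl_comp_proj_apply[OF t that] that by (simp add: sset_apply_ident)
  then have "enc t ` A = A"
    by auto
  then show False
    using enc_idempotent[OF t] by (simp add: idempotents_def ordLess_irreflexive)
qed

text \<open>A map from a constant discrete pro-object to \<open>E\<close> is determined by where each point goes in
  the product of the vertex sets of \<open>E\<close>, so it identifies all points with the same image there.\<close>

lemma pro_map_factors:
  assumes E: "E \<in> pro_objects V (sset_model V)"
    and less: "|\<Pi>\<^sub>E s \<in> Obj (Shape E). ObM (ObM E s) 0| <o |A|"
    and \<phi>: "\<phi> \<in> pro_Hom (sset_model V) (constant_pro (sset_model V) w (discrete A)) E"
  shows "\<exists>t \<in> T. \<forall>s \<in> Obj (Shape E). \<forall>m. (w, m) \<in> \<phi> s \<longrightarrow>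
    m \<cdot>\<^bsub>sset_category V\<^esub> (incl t \<cdot>\<^bsub>sset_category V\<^esub> proj t) = m"
proof -
  let ?S = "sset_category V" and ?C = "sset_model V"
  let ?X = "constant_pro ?C w (discrete A)"
  have X: "?X \<in> pro_objects V ?C"
    using constant_pro_in_pro_objects[OF is_category_sset_model V] discrete_in_Obj[OF A(1)] by simp
  have m: "m \<in> Hom ?S (discrete A) (ObM E s)" and \<phi>_eq: "\<phi> s = {(w, m)}"
    if s: "s \<in> Obj (Shape E)" and wm: "(w, m) \<in> \<phi> s" for s m
  proof -
    note rep = pro_Hom_rep[OF is_category_sset_model X \<phi> s wm]
    show "m \<in> Hom ?S (discrete A) (ObM E s)"
      using rep(2) by simp
    show "\<phi> s = {(w, m)}"
      unfolding rep(3) using rep(2)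
      by (intro colim_rel_constant_pro[OF is_category_sset_model]) simp
  qed
  have ex: "\<exists>m. (w, m) \<in> \<phi> s" if s: "s \<in> Obj (Shape E)" for s
  proof -
    obtain w' m where wm: "(w', m) \<in> \<phi> s"
      using pro_Hom_nonempty[OF is_category_sset_model X \<phi> s] .
    then have "w' = w"
      using pro_Hom_rep(1)[OF is_category_sset_model X \<phi> s wm] by simp
    with wm show ?thesis
      by blast
  qed
  \<comment> \<open>\<open>F\<close> is the induced map from \<open>A\<close> to the product of the
    vertex sets. Each \<open>\<phi> s\<close> is a singleton, so \<open>SOME\<close> has no
    freedom.\<close>
  define F where "F = (\<lambda>x. \<lambda>s \<in> Obj (Shape E). sset_apply (SOME m. (w, m) \<in> \<phi> s) 0 x)"
  have F: "F x s = sset_apply m 0 x" if "s \<in> Obj (Shape E)" "(w, m) \<in> \<phi> s" for x s m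
    by (simp add: F_def that(1) \<phi>_eq[OF that])
  have "F x \<in> (\<Pi>\<^sub>E s \<in> Obj (Shape E). ObM (ObM E s) 0)" if x: "x \<in> A" for x
  proof (rule PiE_I)
    fix s assume s: "s \<in> Obj (Shape E)"
    obtain m where wm: "(w, m) \<in> \<phi> s"
      using ex[OF s] by blast
    have "sset_apply m 0 \<in> A \<rightarrow>\<^sub>E ObM (ObM E s) 0"
      using in_sset_HomE[OF m[OF s wm]] by (metis ObM_discrete)
    then show "F x s \<in> ObM (ObM E s) 0"
      using F[OF s wm] x by auto
  qed (simp add: F_def)
  then have "F ` A \<subseteq> (\<Pi>\<^sub>E s \<in> Obj (Shape E). ObM (ObM E s) 0)"
    by blast
  then have "|F ` A| <o |A|"
    using less card_of_mono1 ordLeq_ordLess_trans by blast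
  \<comment> \<open>Since \<open>F\<close> records all levels simultaneously, the single idempotent
    \<open>e\<close> serves every \<open>s\<close>.\<close>
  then obtain e where e: "e \<in> idempotents A" and Fe: "\<And>x. x \<in> A \<Longrightarrow> F (e x) = F x"
    using idempotent_with_kernel by blast
  obtain t where t: "t \<in> T" "enc t = e"
    using obtain_index[OF e] .
  have "m \<cdot>\<^bsub>?S\<^esub> (incl t \<cdot>\<^bsub>?S\<^esub> proj t) = m" if s: "s \<in> Obj (Shape E)" and wm: "(w, m) \<in> \<phi> s" for s m
  proof (rule discrete_map_eqI)
    note iq = incl_comp_proj_in_Hom[OF t(1)] and m = m[OF s wm]
    show "m \<cdot>\<^bsub>?S\<^esub> (incl t \<cdot>\<^bsub>?S\<^esub> proj t) \<in> Hom ?S (discrete A) (ObM E s)"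
      using comp_in_Hom[OF is_category_sset_category m iq] .
    show "m \<in> Hom ?S (discrete A) (ObM E s)"
      by (rule m)
    fix x assume x: "x \<in> A"
    have "sset_apply (m \<cdot>\<^bsub>?S\<^esub> (incl t \<cdot>\<^bsub>?S\<^esub> proj t)) 0 x = sset_apply m 0 (e x)"
      using sset_apply_comp[OF iq m, of x 0] incl_comp_proj_apply[OF t(1) x] x t(2) by simp
    also have "\<dots> = sset_apply m 0 x"
      using Fe[OF x] F[OF s wm] by metis
    finally show "sset_apply (m \<cdot>\<^bsub>?S\<^esub> (incl t \<cdot>\<^bsub>?S\<^esub> proj t)) 0 x = sset_apply m 0 x" .
  qed
  then show ?thesis
    using t(1) by blast
qed

end

section \<open>The strict model structure is not fibrantly generated\<close>

lemma strict_pro_simps: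
  "Arr (strict_pro V C) = Arr (pro_category V C)"
  "Cofib (strict_pro V C) = {f \<in> Arr (pro_category V C). essentially_levelwise V C (Cofib C) f}"
  "has_left_lifting (strict_pro V C) f p = has_left_lifting (pro_category V C) f p"
  by (simp_all add: strict_pro_def category.defs has_left_lifting_def Hom_def)

theorem proposition5p6:
  assumes "inaccessible_universe TYPE('v)"
  shows "\<not> fibrantly_generated TYPE('v) (strict_pro TYPE('v) (sset_model TYPE('v)))"
proof
  let ?V = "TYPE('v)"
  let ?C = "sset_model ?V"
  let ?P = "pro_category ?V ?C"
  let ?W = "\<lambda>E :: ('v, 'v sset, 'v sset_map) pro_object. \<Pi>\<^sub>E s \<in> Obj (Shape E). ObM (ObM E s) 0"
  assume "fibrantly_generated ?V (strict_pro ?V ?C)"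
  then obtain J where "J \<subseteq> Arr (strict_pro ?V ?C)" and small_J: "small ?V J"
    and lift: "\<forall>f \<in> Arr (strict_pro ?V ?C). f \<in> Cofib (strict_pro ?V ?C) \<longleftrightarrow>
      (\<forall>p \<in> J. has_left_lifting (strict_pro ?V ?C) f p)"
    unfolding fibrantly_generated_def by (elim exE conjE)
  then have J: "J \<subseteq> Arr ?P"
    by (simp add: strict_pro_simps)
  \<comment> \<open>The direction in use: lifting against all of \<open>J\<close> forces a map to be
    essentially levelwise a cofibration.\<close>
  have Cofib: "essentially_levelwise ?V ?C (Cofib ?C) f"
    if "f \<in> Arr ?P" "\<And>p. p \<in> J \<Longrightarrow> has_left_lifting ?P f p" for f
    using lift that unfolding strict_pro_simps by simp
  have Dom_J: "Dom ?P p \<in> pro_objects ?V ?C" if "p \<in> J" for p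
    using J that by (auto simp: pro_category_def)
  have small_W: "small ?V (?W (Dom ?P p))" if "p \<in> J" for p
  proof (rule small_PiE[OF assms])
    let ?E = "Dom ?P p"
    have E: "cofiltered ?V (Shape ?E)" "is_functor ?C ?E"
      using Dom_J[OF that] by (simp_all add: pro_objects_def)
    show "small ?V (Obj (Shape ?E))"
      using E(1) by (simp add: cofiltered_def)
    show "small ?V (ObM (ObM ?E s) 0)" if "s \<in> Obj (Shape ?E)" for s
      using sset_small functor_Obj[OF E(2) that] by simp
  qed
  \<comment> \<open>The disjoint union dominates the vertex product of every domain in
    \<open>J\<close>; the summand of natural numbers makes it infinite even if these products are
    few and finite.\<close>
  define U where "U = (SIGMA p : J. ?W (Dom ?P p)) <+> (UNIV :: nat set)"
  have "small ?V (SIGMA p : J. ?W (Dom ?P p))"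
    by (rule small_Sigma[OF assms small_J small_W])
  then have "small ?V U"
    unfolding U_def using small_nat[OF assms] infinite_universe[OF assms]
    unfolding small_def by (intro card_of_Plus_ordLess_infinite)
  then have small_Pow_U: "small ?V (Pow U)"
    by (rule small_Pow[OF assms])
  \<comment> \<open>A copy of the power set of \<open>U\<close> in \<open>'v\<close> is strictly
    larger than \<open>U\<close> by Cantor's theorem and still small by inaccessibility.\<close>
  obtain A :: "'v set" and f where "bij_betw f A (Pow U)"
    using small_copy[OF small_Pow_U] .
  then have A_iso: "|Pow U| =o |A|"
    using card_of_ordIsoI ordIso_symmetric by blast
  then have A: "small ?V A"
    using small_le[OF small_Pow_U] ordIso_imp_ordLeq ordIso_symmetric by blast
  have less: "|U| <o |A|"
    using card_of_Pow A_iso by (rule ordLess_ordIso_trans)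
  then have inf_A: "infinite A"
    using card_of_ordLeq_finite[OF ordLess_imp_ordLeq[OF less]] by (auto simp: U_def finite_Plus_iff)
  have less_W: "|?W (Dom ?P p)| <o |A|" if "p \<in> J" for p
  proof -
    have "inj_on (\<lambda>x. Inl (p, x)) (?W (Dom ?P p))"
      by (simp add: inj_on_def)
    then have "|?W (Dom ?P p)| \<le>o |U|"
      using that by (intro card_of_ordLeqI) (auto simp: U_def)
    then show ?thesis
      using less by (rule ordLeq_ordLess_trans)
  qed
  obtain T :: "'v set" and enc where enc: "bij_betw enc T (idempotents A)"
    using small_copy[OF small_idempotents[OF assms A]] .
  define r where "r = {(s, t) \<in> T \<times> T. \<forall>x \<in> A. enc s (enc t x) = enc s x}"
  note ctx = assms A inf_A enc r_def
  interpret split_idempotents ?V ?C "discrete A" r "\<lambda>t. discrete (enc t ` A)"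
    "\<lambda>t. discrete_map A (discrete (enc t ` A)) (enc t)"
    "\<lambda>t. discrete_map (enc t ` A) (discrete A) id"
    by (rule split_idempotents_quotients[OF ctx])
  have "has_left_lifting ?P (projection w) p" if p: "p \<in> J" for p and w :: 'v
    using J p pro_map_factors[OF ctx Dom_J[OF p] less_W[OF p]]
    by (intro projection_has_left_lifting) (auto simp: Field_index[OF ctx])
  then have "essentially_levelwise ?V ?C (Cofib ?C) (projection w)" for w :: 'v
    by (rule Cofib[OF projection_in_Arr])
  then have "\<exists>t \<in> Field r. discrete_map (enc t ` A) (discrete A) id \<cdot>\<^bsub>?C\<^esub>
      discrete_map A (discrete (enc t ` A)) (enc t) = Ident ?C (discrete A)"
    by (rule essentially_levelwise_monic_projectionD) (simp add: monic_in_def)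
  then show False
    using incl_comp_proj_neq_ident[OF ctx] by (simp add: Field_index[OF ctx])
qed

end
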